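(* Let $\mathbf{G}$ be a Kac-Moody group of untwisted affine ADE type, i.e. the untwisted affinization of a simply-laced (ADE) finite-type Kac-Moody group $\mathbf{G}_0$. Let $x,y \in W_{\mathcal{T}}$. Then $x \lhd y$ (i.e. $y$ covers $x$ in the Bruhat order on $W_{\mathcal{T}}$) if and only if $x < y$ and $\ell(x) = \ell(y) - 1$.
   Context: Setup. $\mathbf{G}$ is a Kac-Moody group with finitely many simple roots $\alpha_i$ and simple coroots $\alpha_i^\vee$, $W$ is its Weyl group, $\Delta$ its set of real roots, $\Delta^+\subset\Delta$ the positive real roots. $P$ is the coweight lattice of $\mathbf{G}$ (it contains the coroots and carries an action of $W$), and $\langle\cdot,\cdot\rangle$ is the canonical $W$-invariant pairing between $P$ and the root lattice. For $\beta\in\Delta$, $\beta^\vee$ is the associated coroot and $s_\beta\in W$ the reflection. A coweight $\mu\in P$ is dominant if $\langle\mu,\alpha_i\rangle\ge 0$ for all $i$. The Tits cone $\mathcal{T}\subset P$ is the set of $\mu\in P$ such that $w(\mu)$ is dominant for some $w\in W$; $\mu_+$ denotes the unique dominant element of the $W$-orbit of $\mu\in\mathcal{T}$. $W_P=P\rtimes W$ has elements written $\pi^\mu w$ ($\mu\in P$, $w\in W$), and $W_{\mathcal{T}}=\mathcal{T}\rtimes W=\{\pi^\mu w : \mu\in\mathcal{T}, w\in W\}$ is a subsemigroup of $W_P$. $\mathbf{G}$-affine (double-affine) roots: $\tilde\Delta=\{\beta+n\pi : \beta\in\Delta, n\in\mathbb{Z}\}\subset \mathbb{Z}\Delta\oplus\mathbb{Z}\pi$,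 where $\pi$ is a formal symbol. $\beta+n\pi$ is positive ($>0$) if ($\beta\in\Delta^+$ and $n\ge 0$) or ($\beta\in-\Delta^+$ and $n>0$); otherwise it is negative ($<0$). $\tilde\Delta^+$ is the set of positive elements. For $\beta\in\Delta^+$, $n\in\mathbb{Z}$, set $\beta[n]=\mathrm{sgn}(n)(\beta+n\pi)$, where $\mathrm{sgn}(n)=+1$ if $n\ge0$ and $-1$ if $n<0$; every element of $\tilde\Delta^+$ is uniquely of the form $\beta[n]$. $W_P$ acts on $\tilde\Delta$ by $\pi^\mu w(\beta+n\pi)=w(\beta)+(n+\langle\mu,w(\beta)\rangle)\pi$. The reflection of $\beta[n]$ is $s_{\beta[n]}=\pi^{n\beta^\vee}s_\beta\in W_P$. Bruhat order: for $x\in W_{\mathcal{T}}$ and $\beta[n]\in\tilde\Delta^+$ with $xs_{\beta[n]}\in W_{\mathcal{T}}$ and $x(\beta[n])>0$, declare $xs_{\beta[n]}>x$; the Bruhat order $\leq$ on $W_{\mathcal{T}}$ is the reflexive and transitive closure of these relations (it is known to be a partial order). $x\lhd y$ means $x<y$ and there is no $z\in W_{\mathcal{T}}$ with $x<z<y$. Length function: fix $\rho$, a sum of fundamental weights, so $\langle\alpha_i^\vee,\rho\rangle=1$ for all $i$. For $\mu\in P$ put $2\cdot\mathrm{ht}(\mu)=\lfloor\langle\mu,2\rho\rangle\rfloor$. For $w\in W$ let $\mathrm{Inv}(w)=\{\gamma\in\Delta^+ : w(\gamma)\in-\Delta^+\}$. For $\pi^\mu w\in W_{\mathcal{T}}$,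 $$\ell(\pi^\mu w)=2\cdot\mathrm{ht}(\mu_+)+\#\{\gamma\in\mathrm{Inv}(w^{-1}) : \langle\mu,\gamma\rangle\ge0\}-\#\{\gamma\in\mathrm{Inv}(w^{-1}) : \langle\mu,\gamma\rangle<0\}.$$ *)

theory Defs
  imports "HOL-Analysis.Finite_Cartesian_Product"
begin

section \<open>Kac-Moody root data\<close>

text \<open>The coweight lattice \<open>P\<close> and the weight lattice are both \<open>int ^ 'r\<close>, put in duality by the
  standard pairing; coweights are always the first argument. The simple roots are weights, so
  the root lattice is the sublattice of the weight lattice they span.\<close>

record ('i, 'r) km_datum =
  simple_root :: "'i \<Rightarrow> int ^ 'r"
  simple_coroot :: "'i \<Rightarrow> int ^ 'r"

definition pairing :: "int ^ 'r::finite \<Rightarrow> int ^ 'r \<Rightarrow> int" where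
  "pairing \<mu> \<eta> = (\<Sum>k\<in>UNIV. \<mu> $ k * \<eta> $ k)"

definition real_pairing :: "int ^ 'r::finite \<Rightarrow> real ^ 'r \<Rightarrow> real" where
  "real_pairing \<mu> \<eta> = (\<Sum>k\<in>UNIV. real_of_int (\<mu> $ k) * \<eta> $ k)"

definition gcm :: "('i::finite, 'r::finite) km_datum \<Rightarrow> 'i \<Rightarrow> 'i \<Rightarrow> int" where
  "gcm D i j = pairing (simple_coroot D i) (simple_root D j)"

definition lin_indep :: "('i::finite \<Rightarrow> int ^ 'r::finite) \<Rightarrow> bool" where
  "lin_indep v \<longleftrightarrow> (\<forall>c :: 'i \<Rightarrow> int. (\<Sum>i\<in>UNIV. c i *s v i) = 0 \<longrightarrow> (\<forall>i. c i = 0))"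

text \<open>Linear independence of the simple roots is what makes \<open>W\<close> act faithfully on \<open>P\<close>, so that
  below \<open>W\<close> can be taken to be a group of maps on \<open>P\<close>. In finite type both independence
  conditions follow from the nondegeneracy of the Cartan matrix.\<close>

definition kac_moody :: "('i::finite, 'r::finite) km_datum \<Rightarrow> bool" where
  "kac_moody D \<longleftrightarrow>
     (\<forall>i. gcm D i i = 2) \<and>
     (\<forall>i j. i \<noteq> j \<longrightarrow> gcm D i j \<le> 0) \<and>
     (\<forall>i j. gcm D i j = 0 \<longrightarrow> gcm D j i = 0) \<and>
     lin_indep (simple_root D) \<and> lin_indep (simple_coroot D)"

definition finite_type :: "('i::finite, 'r::finite) km_datum \<Rightarrow> bool" where
  "finite_type D \<longleftrightarrow>
     (\<exists>d :: 'i \<Rightarrow> real.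
        (\<forall>i. d i > 0) \<and>
        (\<forall>i j. d i * of_int (gcm D i j) = d j * of_int (gcm D j i)) \<and>
        (\<forall>v :: 'i \<Rightarrow> real. (\<exists>i. v i \<noteq> 0) \<longrightarrow>
           (\<Sum>i\<in>UNIV. \<Sum>j\<in>UNIV. v i * (d i * of_int (gcm D i j)) * v j) > 0))"

definition indecomposable :: "('i::finite, 'r::finite) km_datum \<Rightarrow> bool" where
  "indecomposable D \<longleftrightarrow>
     \<not> (\<exists>J. J \<noteq> {} \<and> J \<noteq> UNIV \<and> (\<forall>i\<in>J. \<forall>j\<in>- J. gcm D i j = 0))"

definition simply_laced :: "('i::finite, 'r::finite) km_datum \<Rightarrow> bool" where
  "simply_laced D \<longleftrightarrow> (\<forall>i j. i \<noteq> j \<longrightarrow> gcm D i j \<in> {0, - 1})"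

definition ADE_type :: "('i::finite, 'r::finite) km_datum \<Rightarrow> bool" where
  "ADE_type D \<longleftrightarrow> kac_moody D \<and> finite_type D \<and> indecomposable D \<and> simply_laced D"

section \<open>Weyl group, real roots, Tits cone\<close>

definition simple_reflection ::
    "('i::finite, 'r::finite) km_datum \<Rightarrow> 'i \<Rightarrow> int ^ 'r \<Rightarrow> int ^ 'r" where
  "simple_reflection D i \<mu> = \<mu> - pairing \<mu> (simple_root D i) *s simple_coroot D i"

inductive_set weyl :: "('i::finite, 'r::finite) km_datum \<Rightarrow> (int ^ 'r \<Rightarrow> int ^ 'r) set"
  for D :: "('i, 'r) km_datum" where
  weyl_id: "id \<in> weyl D"
| weyl_step: "w \<in> weyl D \<Longrightarrow> simple_reflection D i \<circ> w \<in> weyl D"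

text \<open>The contragredient action on weights, characterised by
  \<open>pairing (w \<mu>) (dual_act w \<eta>) = pairing \<mu> \<eta>\<close>.\<close>

definition dual_act :: "(int ^ 'r::finite \<Rightarrow> int ^ 'r) \<Rightarrow> int ^ 'r \<Rightarrow> int ^ 'r" where
  "dual_act w \<eta> = (\<chi> k. pairing (inv w (axis k 1)) \<eta>)"

definition real_roots :: "('i::finite, 'r::finite) km_datum \<Rightarrow> (int ^ 'r) set" where
  "real_roots D = {dual_act w (simple_root D i) | w i. w \<in> weyl D}"

definition nonneg_comb :: "('i::finite, 'r::finite) km_datum \<Rightarrow> int ^ 'r \<Rightarrow> bool" where
  "nonneg_comb D \<eta> \<longleftrightarrow> (\<exists>c :: 'i \<Rightarrow> nat. \<eta> = (\<Sum>i\<in>UNIV. int (c i) *s simple_root D i))"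

definition pos_roots :: "('i::finite, 'r::finite) km_datum \<Rightarrow> (int ^ 'r) set" where
  "pos_roots D = {\<beta> \<in> real_roots D. nonneg_comb D \<beta>}"

definition coroot :: "('i::finite, 'r::finite) km_datum \<Rightarrow> int ^ 'r \<Rightarrow> int ^ 'r" where
  "coroot D \<beta> = (THE \<gamma>. \<exists>w\<in>weyl D. \<exists>i.
      \<beta> = dual_act w (simple_root D i) \<and> \<gamma> = w (simple_coroot D i))"

definition reflection ::
    "('i::finite, 'r::finite) km_datum \<Rightarrow> int ^ 'r \<Rightarrow> int ^ 'r \<Rightarrow> int ^ 'r" where
  "reflection D \<beta> \<mu> = \<mu> - pairing \<mu> \<beta> *s coroot D \<beta>"

definition dominant :: "('i::finite, 'r::finite) km_datum \<Rightarrow> int ^ 'r \<Rightarrow> bool" where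
  "dominant D \<mu> \<longleftrightarrow> (\<forall>i. pairing \<mu> (simple_root D i) \<ge> 0)"

definition tits_cone :: "('i::finite, 'r::finite) km_datum \<Rightarrow> (int ^ 'r) set" where
  "tits_cone D = {\<mu>. \<exists>w\<in>weyl D. dominant D (w \<mu>)}"

definition dominant_rep :: "('i::finite, 'r::finite) km_datum \<Rightarrow> int ^ 'r \<Rightarrow> int ^ 'r" where
  "dominant_rep D \<mu> = (THE \<nu>. dominant D \<nu> \<and> (\<exists>w\<in>weyl D. \<nu> = w \<mu>))"

section \<open>The semigroup \<open>W\<^sub>T\<close> and its Bruhat order\<close>

text \<open>The pair \<open>(\<mu>, w)\<close> stands for \<open>\<pi>\<^sup>\<mu> w\<close>, and the pair \<open>(\<beta>, n)\<close> for the affine root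
  \<open>\<beta> + n\<pi>\<close>.\<close>

type_synonym 'r waff = "(int ^ 'r) \<times> (int ^ 'r \<Rightarrow> int ^ 'r)"
type_synonym 'r aroot = "(int ^ 'r) \<times> int"

definition wmult :: "'r::finite waff \<Rightarrow> 'r waff \<Rightarrow> 'r waff" where
  "wmult x y = (fst x + snd x (fst y), snd x \<circ> snd y)"

definition W_T :: "('i::finite, 'r::finite) km_datum \<Rightarrow> 'r waff set" where
  "W_T D = tits_cone D \<times> weyl D"

definition aroot_pos :: "('i::finite, 'r::finite) km_datum \<Rightarrow> 'r aroot \<Rightarrow> bool" where
  "aroot_pos D = (\<lambda>(\<beta>, n). (\<beta> \<in> pos_roots D \<and> n \<ge> 0) \<or> (- \<beta> \<in> pos_roots D \<and> n > 0))"

text \<open>\<open>\<beta>[n] = sgn(n) (\<beta> + n\<pi>)\<close> with the convention \<open>sgn(0) = 1\<close>, unlike the library's \<open>sgn\<close>.\<close>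

definition aroot_of :: "int ^ 'r::finite \<Rightarrow> int \<Rightarrow> 'r aroot" where
  "aroot_of \<beta> n = (if n \<ge> 0 then (\<beta>, n) else (- \<beta>, - n))"

definition aroot_act :: "'r::finite waff \<Rightarrow> 'r aroot \<Rightarrow> 'r aroot" where
  "aroot_act = (\<lambda>(\<mu>, w) (\<beta>, n). (dual_act w \<beta>, n + pairing \<mu> (dual_act w \<beta>)))"

definition areflection ::
    "('i::finite, 'r::finite) km_datum \<Rightarrow> int ^ 'r \<Rightarrow> int \<Rightarrow> 'r waff" where
  "areflection D \<beta> n = (n *s coroot D \<beta>, reflection D \<beta>)"

definition bruhat_step ::
    "('i::finite, 'r::finite) km_datum \<Rightarrow> 'r waff \<Rightarrow> 'r waff \<Rightarrow> bool" where
  "bruhat_step D x y \<longleftrightarrow> x \<in> W_T D \<and> y \<in> W_T D \<and>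
     (\<exists>\<beta>\<in>pos_roots D. \<exists>n. y = wmult x (areflection D \<beta> n) \<and>
        aroot_pos D (aroot_act x (aroot_of \<beta> n)))"

definition bruhat_le ::
    "('i::finite, 'r::finite) km_datum \<Rightarrow> 'r waff \<Rightarrow> 'r waff \<Rightarrow> bool" where
  "bruhat_le D x y \<longleftrightarrow> x \<in> W_T D \<and> y \<in> W_T D \<and> (bruhat_step D)\<^sup>*\<^sup>* x y"

definition bruhat_less ::
    "('i::finite, 'r::finite) km_datum \<Rightarrow> 'r waff \<Rightarrow> 'r waff \<Rightarrow> bool" where
  "bruhat_less D x y \<longleftrightarrow> bruhat_le D x y \<and> x \<noteq> y"

definition bruhat_covers ::
    "('i::finite, 'r::finite) km_datum \<Rightarrow> 'r waff \<Rightarrow> 'r waff \<Rightarrow> bool" where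
  "bruhat_covers D x y \<longleftrightarrow> bruhat_less D x y \<and>
     \<not> (\<exists>z\<in>W_T D. bruhat_less D x z \<and> bruhat_less D z y)"

section \<open>Length function\<close>

text \<open>Fundamental weights are only determined up to weights orthogonal to all coroots, and need
  not be integral on \<open>P\<close> (hence the floor in the definition of height).\<close>

definition sum_of_fundamental_weights ::
    "('i::finite, 'r::finite) km_datum \<Rightarrow> real ^ 'r \<Rightarrow> bool" where
  "sum_of_fundamental_weights D \<rho> \<longleftrightarrow>
     (\<exists>\<Lambda> :: 'i \<Rightarrow> real ^ 'r.
        (\<forall>i j. real_pairing (simple_coroot D j) (\<Lambda> i) = (if i = j then 1 else 0)) \<and>
        \<rho> = (\<Sum>i\<in>UNIV. \<Lambda> i))"

definition two_ht :: "real ^ 'r::finite \<Rightarrow> int ^ 'r \<Rightarrow> int" where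
  "two_ht \<rho> \<mu> = \<lfloor>real_pairing \<mu> (2 *s \<rho>)\<rfloor>"

definition Inv ::
    "('i::finite, 'r::finite) km_datum \<Rightarrow> (int ^ 'r \<Rightarrow> int ^ 'r) \<Rightarrow> (int ^ 'r) set" where
  "Inv D w = {\<gamma> \<in> pos_roots D. - dual_act w \<gamma> \<in> pos_roots D}"

definition len ::
    "('i::finite, 'r::finite) km_datum \<Rightarrow> real ^ 'r \<Rightarrow> 'r waff \<Rightarrow> int" where
  "len D \<rho> = (\<lambda>(\<mu>, w). two_ht \<rho> (dominant_rep D \<mu>)
     + int (card {\<gamma> \<in> Inv D (inv w). pairing \<mu> \<gamma> \<ge> 0})
     - int (card {\<gamma> \<in> Inv D (inv w). pairing \<mu> \<gamma> < 0}))"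

section \<open>Untwisted affinization\<close>

text \<open>The affinization has coweight lattice \<open>\<int>c \<oplus> P\<^sub>0 \<oplus> \<int>d\<close>; the coordinates \<open>Cent\<close> and \<open>Deg\<close>
  are the coefficients of the central coweight \<open>c\<close> and the degree coweight \<open>d\<close>. In the dual
  lattice, the \<open>Deg\<close> basis vector is the imaginary root \<open>\<delta>\<close>. The extra simple root and coroot,
  indexed by \<open>None\<close>, are \<open>\<delta> - \<theta>\<close> and \<open>c - \<theta>\<^sup>\<or>\<close>.\<close>

datatype 'r aff_coord = Cent | Fin 'r | Deg

instance aff_coord :: (finite) finite
proof
  have "(UNIV :: 'a aff_coord set) = insert Cent (insert Deg (range Fin))"
    by (auto intro: aff_coord.exhaust)
  then show "finite (UNIV :: 'a aff_coord set)"
    by (metis finite finite_imageI finite_insert)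
qed

definition aff_vec :: "int \<Rightarrow> int ^ 'r::finite \<Rightarrow> int \<Rightarrow> int ^ 'r aff_coord" where
  "aff_vec m v n = (\<chi> k. case k of Cent \<Rightarrow> m | Fin k' \<Rightarrow> v $ k' | Deg \<Rightarrow> n)"

definition highest_root :: "('i::finite, 'r::finite) km_datum \<Rightarrow> int ^ 'r" where
  "highest_root D = (THE \<theta>. \<theta> \<in> real_roots D \<and> (\<forall>\<beta>\<in>real_roots D. nonneg_comb D (\<theta> - \<beta>)))"

definition affinization ::
    "('i::finite, 'r::finite) km_datum \<Rightarrow> ('i option, 'r aff_coord) km_datum" where
  "affinization D =
     \<lparr> simple_root = (\<lambda>k. case k of
           None \<Rightarrow> aff_vec 0 (- highest_root D) 1
         | Some i \<Rightarrow> aff_vec 0 (simple_root D i) 0),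
       simple_coroot = (\<lambda>k. case k of
           None \<Rightarrow> aff_vec 1 (- coroot D (highest_root D)) 0
         | Some i \<Rightarrow> aff_vec 0 (simple_coroot D i) 0) \<rparr>"

end

theory Submission
  imports Defs
begin

text \<open>A reflection \<open>s\<close> in a positive double-affine root \<open>r = \<eta> + m\<pi>\<close> with \<open>x\<^sup>-\<^sup>1 r > 0\<close> raises the
  length by exactly the number of positive double-affine roots \<open>q\<close> such that \<open>- s q\<close>,
  \<open>x\<^sup>-\<^sup>1 q\<close> and \<open>- x\<^sup>-\<^sup>1 s q\<close> are positive as well. As \<open>r\<close> is one of them, the length is strictly
  increasing. If it grows by at least 2, there is a second such root \<open>q = \<gamma> + n\<pi>\<close>, and in the affine
  simply-laced case \<open>\<langle>\<eta>\<^sup>\<or>, \<gamma>\<rangle>\<close> is 1 or 2. In the first case \<open>r = q + q'\<close> spans a system of type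
  \<open>A\<^sub>2\<close> and \<open>s = s\<^sub>q s\<^sub>q\<^sub>' s\<^sub>q\<close> factors into three increasing steps. In the second case \<open>q - r\<close> is a
  combination of \<open>\<delta>\<close> and \<open>\<pi>\<close>, and the infinite dihedral group of the string
  \<open>r + \<int>(q - r)\<close> provides such a factorization.\<close>

section \<open>Pairing and root lattices\<close>

text \<open>An element of \<open>W_T D\<close> can make infinitely many positive double-affine roots
  negative, so \<open>len\<close> is not an inversion count. Only differences are finite: between
  \<open>x\<close> and \<open>s x\<close> the change of the height term cancels against a sum of
  pairings, and a finite sum over directions \<open>\<gamma>\<close> remains. In one direction,
  positivity of \<open>\<gamma> + n\<pi>\<close>, or of its image under the inverse of
  \<open>x\<close>, is a lower bound on \<open>n\<close>; the roots counted in the overview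
  therefore fill the overlap of two integer intervals. The symmetric Cartan matrix identifies roots
  with coroots compatibly with the Weyl group. Semidefiniteness of its form bounds pairings of roots
  by 2, and its rank-one radical forces roots with pairing 2 to differ by a multiple of
  \<open>\<delta>\<close>. The obstacle to refining a step is that \<open>W_T D\<close> is only a
  semigroup: translation parts of intermediate elements must stay in the Tits cone. In affine type
  this is controlled by the level, the pairing with \<open>\<delta>\<close>. In the dihedral case
  the path turns where the string stops being positive on both sides, so it must be shown that the
  string does stop.\<close>

lemma pairing_add_left: "pairing (a + b) x = pairing a x + pairing b x"
  by (simp add: pairing_def algebra_simps sum.distrib)
lemma pairing_add_right: "pairing x (a + b) = pairing x a + pairing x b"
  by (simp add: pairing_def algebra_simps sum.distrib)
lemma pairing_diff_left: "pairing (a - b) x = pairing a x - pairing b x"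
  by (simp add: pairing_def algebra_simps sum_subtractf)
lemma pairing_diff_right: "pairing x (a - b) = pairing x a - pairing x b"
  by (simp add: pairing_def algebra_simps sum_subtractf)
lemma pairing_minus_left: "pairing (- a) x = - pairing a x"
  by (simp add: pairing_def sum_negf)
lemma pairing_minus_right: "pairing x (- a) = - pairing x a"
  by (simp add: pairing_def sum_negf)
lemma pairing_zero_left: "pairing 0 x = 0" and pairing_zero_right: "pairing x 0 = 0"
  by (simp_all add: pairing_def)
lemma pairing_smult_left: "pairing (k *s a) x = k * pairing a x"
  by (simp add: pairing_def algebra_simps sum_distrib_left)
lemma pairing_smult_right: "pairing x (k *s a) = k * pairing x a"
  by (simp add: pairing_def algebra_simps sum_distrib_left)
lemma pairing_sum_left: "pairing (\<Sum>i\<in>A. f i) x = (\<Sum>i\<in>A. pairing (f i) x)"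
  by (induction A rule: infinite_finite_induct) (auto simp: pairing_zero_left pairing_add_left)
lemma pairing_sum_right: "pairing x (\<Sum>i\<in>A. f i) = (\<Sum>i\<in>A. pairing x (f i))"
  by (induction A rule: infinite_finite_induct) (auto simp: pairing_zero_right pairing_add_right)
lemma pairing_axis_left: "pairing (axis k 1) x = x $ k"
  unfolding pairing_def axis_def by (simp add: if_distrib[of "\<lambda>a. a * _"] cong: if_cong)

lemmas pairing_simps = pairing_add_left pairing_add_right pairing_diff_left pairing_diff_right
  pairing_minus_left pairing_minus_right pairing_zero_left pairing_zero_right
  pairing_smult_left pairing_smult_right

lemma vec_expand_axis: "(\<mu> :: int ^ 'r::finite) = (\<Sum>k\<in>UNIV. \<mu> $ k *s axis k 1)"
  by (simp add: vec_eq_iff axis_def if_distrib[of "\<lambda>a. _ * a"] cong: if_cong)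

definition zlinear :: "(int ^ 'r::finite \<Rightarrow> int ^ 'r) \<Rightarrow> bool" where
  "zlinear w \<longleftrightarrow> (\<forall>a b. w (a + b) = w a + w b) \<and> (\<forall>k a. w (k *s a) = k *s w a)"

lemma zlinear_add: "zlinear w \<Longrightarrow> w (a + b) = w a + w b"
  and zlinear_smult: "zlinear w \<Longrightarrow> w (k *s a) = k *s w a"
  by (auto simp: zlinear_def)

lemma zlinear_zero: "zlinear w \<Longrightarrow> w 0 = 0"
  using zlinear_add[of w 0 0] by simp

lemma zlinear_minus: "zlinear w \<Longrightarrow> w (- a) = - w a"
  using zlinear_add[of w a "- a"] zlinear_zero[of w] by (simp add: eq_neg_iff_add_eq_0 add.commute)

lemma zlinear_diff: "zlinear w \<Longrightarrow> w (a - b) = w a - w b"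
  using zlinear_add[of w a "- b"] by (simp add: zlinear_minus)

lemma zlinear_sum: "zlinear w \<Longrightarrow> w (\<Sum>i\<in>A. f i) = (\<Sum>i\<in>A. w (f i))"
  by (induction A rule: infinite_finite_induct) (auto simp: zlinear_zero zlinear_add)

text \<open>The \<open>k\<close>-th coordinate of a weight is its pairing with
  \<open>axis k 1\<close>, and by surjectivity every axis vector has the form
  \<open>w \<mu>\<close>.\<close>

lemma dual_act_unique:
  assumes "surj w" "\<And>\<mu>. pairing (w \<mu>) \<eta>' = pairing \<mu> \<eta>"
  shows "dual_act w \<eta> = \<eta>'"
  unfolding dual_act_def
  by (simp add: vec_eq_iff) (metis assms pairing_axis_left surj_f_inv_f)

definition lat_root :: "('i::finite, 'r::finite) km_datum \<Rightarrow> ('i \<Rightarrow> int) \<Rightarrow> int ^ 'r" where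
  "lat_root D c = (\<Sum>i\<in>UNIV. c i *s simple_root D i)"

definition lat_coroot :: "('i::finite, 'r::finite) km_datum \<Rightarrow> ('i \<Rightarrow> int) \<Rightarrow> int ^ 'r" where
  "lat_coroot D c = (\<Sum>i\<in>UNIV. c i *s simple_coroot D i)"

definition gcm_form :: "('i::finite, 'r::finite) km_datum \<Rightarrow> ('i \<Rightarrow> int) \<Rightarrow> ('i \<Rightarrow> int) \<Rightarrow> int" where
  "gcm_form D c e = (\<Sum>i\<in>UNIV. \<Sum>j\<in>UNIV. c i * gcm D i j * e j)"

lemma pairing_lat: "pairing (lat_coroot D c) (lat_root D e) = gcm_form D c e"
  by (simp add: lat_coroot_def lat_root_def gcm_form_def pairing_sum_left pairing_smult_left)
    (simp add: pairing_sum_right pairing_smult_right gcm_def mult_ac sum_distrib_left)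

lemma lat_root_add: "lat_root D (\<lambda>i. c i + e i) = lat_root D c + lat_root D e"
  and lat_root_diff: "lat_root D (\<lambda>i. c i - e i) = lat_root D c - lat_root D e"
  and lat_root_minus: "lat_root D (\<lambda>i. - c i) = - lat_root D c"
  and lat_root_smult: "lat_root D (\<lambda>i. k * c i) = k *s lat_root D c"
  by (simp_all add: lat_root_def vec_eq_iff algebra_simps sum.distrib sum_subtractf sum_negf
      sum_distrib_left)

lemma lat_coroot_add: "lat_coroot D (\<lambda>i. c i + e i) = lat_coroot D c + lat_coroot D e"
  and lat_coroot_diff: "lat_coroot D (\<lambda>i. c i - e i) = lat_coroot D c - lat_coroot D e"
  and lat_coroot_minus: "lat_coroot D (\<lambda>i. - c i) = - lat_coroot D c"
  and lat_coroot_smult: "lat_coroot D (\<lambda>i. k * c i) = k *s lat_coroot D c"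
  by (simp_all add: lat_coroot_def vec_eq_iff algebra_simps sum.distrib sum_subtractf sum_negf
      sum_distrib_left)

abbreviation unit_at :: "'i \<Rightarrow> 'i \<Rightarrow> int" where
  "unit_at i \<equiv> (\<lambda>j. if j = i then 1 else 0)"

lemma lat_root_unit: "lat_root D (unit_at i) = simple_root D i"
  by (simp add: lat_root_def vec_eq_iff if_distrib[of "\<lambda>a. a * _"] cong: if_cong)
lemma lat_coroot_unit: "lat_coroot D (unit_at i) = simple_coroot D i"
  by (simp add: lat_coroot_def vec_eq_iff if_distrib[of "\<lambda>a. a * _"] cong: if_cong)

lemma real_pairing_diff_left: "real_pairing (a - b) x = real_pairing a x - real_pairing b x"
  by (simp add: real_pairing_def algebra_simps sum_subtractf)
lemma real_pairing_add_left: "real_pairing (a + b) x = real_pairing a x + real_pairing b x"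
  by (simp add: real_pairing_def algebra_simps sum.distrib)
lemma real_pairing_smult_left: "real_pairing (k *s a) x = of_int k * real_pairing a x"
  by (simp add: real_pairing_def algebra_simps sum_distrib_left)
lemma real_pairing_smult_right: "real_pairing a (k *s x) = k * real_pairing a x"
  by (simp add: real_pairing_def algebra_simps sum_distrib_left)

text \<open>An integral shift passes through the floor, so \<open>\<rho>\<close> need not take
  half-integral values on all of the coweight lattice.\<close>

lemma two_ht_diff:
  assumes "2 * real_pairing \<nu> \<rho> = of_int s"
  shows "two_ht \<rho> (\<mu> - \<nu>) = two_ht \<rho> \<mu> - s"
proof -
  have "real_pairing (\<mu> - \<nu>) (2 *s \<rho>) = real_pairing \<mu> (2 *s \<rho>) - of_int s"
    using assms by (simp add: real_pairing_smult_right real_pairing_diff_left)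
  then show ?thesis by (simp add: two_ht_def)
qed

text \<open>For the integer intervals from \<open>a\<close> to \<open>b\<close> and from
  \<open>e\<close> to \<open>f\<close>, the crossed endpoint distances exceed the parallel ones by
  twice the length of the intersection. This turns a difference of absolute values into a
  count.\<close>

lemma interval_overlap:
  fixes a b e f :: int
  assumes "a \<le> b" "e \<le> f"
  shows "\<bar>b - e\<bar> + \<bar>f - a\<bar> - \<bar>a - e\<bar> - \<bar>b - f\<bar> = 2 * max 0 (min b f - max a e)"
  using assms by (auto simp: max_def min_def abs_if)

section \<open>Roots and reflections\<close>

text \<open>Common ground of the finite datum, needed for its highest root, and of its affinization.
  The alternatives in \<open>null\<close> cover both: in the definite case only 0 is null, in the
  affine case the multiples of one strictly positive vector are.\<close>

locale symmetric_datum =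
  fixes D :: "('i::finite, 'r::finite) km_datum"
  assumes diag: "gcm D i i = 2"
    and symm: "gcm D i j = gcm D j i"
    and offdiag: "i \<noteq> j \<Longrightarrow> gcm D i j \<le> 0"
    and indep: "lin_indep (simple_root D)"
    and psd: "gcm_form D c c \<ge> 0"
    and null: "gcm_form D c c = 0 \<Longrightarrow> (\<forall>i. c i = 0) \<or> (\<forall>i. c i > 0) \<or> (\<forall>i. c i < 0)"
begin

abbreviation "\<alpha> \<equiv> simple_root D"
abbreviation "\<alpha>v \<equiv> simple_coroot D"
abbreviation "W \<equiv> weyl D"
abbreviation "sr \<equiv> simple_reflection D"
abbreviation "\<Delta> \<equiv> real_roots D"
abbreviation "\<Delta>p \<equiv> pos_roots D"

section \<open>The Weyl group and its contragredient action\<close>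

lemma pairing_simple: "pairing (\<alpha>v i) (\<alpha> j) = gcm D i j"
  by (simp add: gcm_def)

lemma sr_sr: "sr i (sr i \<mu>) = \<mu>"
  using diag[of i]
  by (simp add: simple_reflection_def pairing_simps pairing_simple vec_eq_iff algebra_simps)

lemma sr_comp: "sr i \<circ> sr i = id"
  by (auto simp: sr_sr)

lemma bij_sr: "bij (sr i)"
  by (metis o_bij sr_comp)

lemma inv_sr: "inv (sr i) = sr i"
  by (metis inv_unique_comp sr_comp)

lemma zlinear_sr: "zlinear (sr i)"
  by (simp add: zlinear_def simple_reflection_def pairing_simps vec_eq_iff algebra_simps)

lemma W_id: "id \<in> W"
  using weyl_id[of D] by (simp add: id_def)

lemma W_step: "w \<in> W \<Longrightarrow> sr i \<circ> w \<in> W"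
  using weyl_step[of w D i] by (simp add: comp_def)

lemma W_induct [consumes 1, case_names id step]:
  assumes "w \<in> W" "P id" "\<And>w i. w \<in> W \<Longrightarrow> P w \<Longrightarrow> P (sr i \<circ> w)"
  shows "P w"
  using assms(1) by (induction rule: weyl.induct) (use assms(2,3) in \<open>auto simp: id_def comp_def\<close>)

lemma W_bij: "w \<in> W \<Longrightarrow> bij w"
  by (induction rule: W_induct) (rule bij_id bij_comp bij_sr | assumption)+

lemma W_zlinear: "w \<in> W \<Longrightarrow> zlinear w"
  by (induction rule: W_induct)
     (use zlinear_sr in \<open>auto simp: zlinear_def\<close>)

lemma W_comp: "v \<in> W \<Longrightarrow> w \<in> W \<Longrightarrow> v \<circ> w \<in> W"
  by (induction rule: W_induct) (metis id_o, metis comp_assoc W_step)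

lemma W_sr: "sr i \<in> W"
  using W_step[OF W_id, of i] by simp

lemma W_inv: "w \<in> W \<Longrightarrow> inv w \<in> W"
proof (induction rule: W_induct)
  case (step w i)
  then show ?case
    by (metis o_inv_distrib[OF bij_sr W_bij] W_comp[OF _ W_sr] inv_sr)
qed (metis W_id inv_id)

lemma inv_W_simps: "w \<in> W \<Longrightarrow> inv w (w \<mu>) = \<mu>" "w \<in> W \<Longrightarrow> w (inv w \<mu>) = \<mu>"
  using W_bij by (simp_all add: bij_is_inj bij_is_surj surj_f_inv_f)

lemma pairing_dual_act_right: 
  assumes "w \<in> W" shows "pairing \<mu> (dual_act w \<eta>) = pairing (inv w \<mu>) \<eta>"
proof -
  have z: "zlinear (inv w)" using assms W_inv W_zlinear by blast
  have "inv w \<mu> = inv w (\<Sum>k\<in>UNIV. \<mu> $ k *s axis k 1)"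
    using vec_expand_axis[of \<mu>] by simp
  also have "\<dots> = (\<Sum>k\<in>UNIV. \<mu> $ k *s inv w (axis k 1))"
    by (simp add: zlinear_sum[OF z] zlinear_smult[OF z])
  finally show ?thesis
    by (simp add: pairing_sum_left pairing_smult_left) (simp add: pairing_def dual_act_def)
qed

lemma pairing_W_dual_act: "w \<in> W \<Longrightarrow> pairing (w \<mu>) (dual_act w \<eta>) = pairing \<mu> \<eta>"
  by (simp add: pairing_dual_act_right inv_W_simps)

lemma dual_act_eqI:
  "w \<in> W \<Longrightarrow> (\<And>\<mu>. pairing (w \<mu>) \<eta>' = pairing \<mu> \<eta>) \<Longrightarrow> dual_act w \<eta> = \<eta>'"
  by (rule dual_act_unique) (auto simp: W_bij bij_is_surj)

lemma dual_act_id: "dual_act id (\<eta> :: int ^ 'r) = \<eta>"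
  by (rule dual_act_eqI[OF W_id]) simp

lemma dual_act_comp:
  "v \<in> W \<Longrightarrow> w \<in> W \<Longrightarrow> dual_act (v \<circ> w) \<eta> = dual_act v (dual_act w \<eta>)"
  by (rule dual_act_eqI) (auto simp: W_comp pairing_W_dual_act)

lemma dual_act_inv: "w \<in> W \<Longrightarrow> dual_act (inv w) (dual_act w \<eta>) = \<eta>"
  "w \<in> W \<Longrightarrow> dual_act w (dual_act (inv w) \<eta>) = \<eta>"
  by (metis W_inv dual_act_comp dual_act_id W_bij bij_is_inj bij_is_surj inv_o_cancel surj_iff)+

lemma dual_act_add: "w \<in> W \<Longrightarrow> dual_act w (a + b) = dual_act w a + dual_act w b"
  and dual_act_minus: "w \<in> W \<Longrightarrow> dual_act w (- a) = - dual_act w a"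
  and dual_act_smult: "w \<in> W \<Longrightarrow> dual_act w (k *s a) = k *s dual_act w a"
  by (auto intro!: dual_act_eqI simp: pairing_simps pairing_W_dual_act)

lemma dual_act_sr: "dual_act (sr i) \<eta> = \<eta> - pairing (\<alpha>v i) \<eta> *s \<alpha> i"
  by (rule dual_act_eqI)
     (use diag[of i] in \<open>auto simp: W_sr simple_reflection_def pairing_simps pairing_simple algebra_simps\<close>)

lemma inj_lat_root: "lat_root D c = lat_root D e \<Longrightarrow> c = e"
proof -
  assume "lat_root D c = lat_root D e"
  then have "(\<Sum>i\<in>UNIV. (c i - e i) *s simple_root D i) = 0"
    using lat_root_diff[of D c e] by (simp add: lat_root_def)
  then have "\<forall>i. c i - e i = 0"
    using indep unfolding lin_indep_def by (elim allE[of _ "\<lambda>i. c i - e i"]) auto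
  then show "c = e" by auto
qed

lemma gcm_form_sym: "gcm_form D c e = gcm_form D e c"
  unfolding gcm_form_def by (subst sum.swap) (simp add: symm mult_ac)

section \<open>Coroots by linear extension, and reflections\<close>

definition rlat :: "(int ^ 'r) set" where "rlat = range (lat_root D)"
text \<open>The linear extension of \<open>\<alpha>\<^sub>i \<mapsto> \<alpha>\<^sub>i\<^sup>\<or>\<close>; as the Cartan matrix is symmetric, it commutes with
  \<open>W\<close> and hence gives the coroot of every real root.\<close>

definition co :: "int ^ 'r \<Rightarrow> int ^ 'r" where "co \<beta> = lat_coroot D (inv (lat_root D) \<beta>)"

lemma co_lat_root: "co (lat_root D c) = lat_coroot D c"
  unfolding co_def using inj_lat_root by (subst inv_f_f) (auto simp: inj_def)

lemma rlatE: "\<beta> \<in> rlat \<Longrightarrow> (\<And>c. \<beta> = lat_root D c \<Longrightarrow> co \<beta> = lat_coroot D c \<Longrightarrow> P) \<Longrightarrow> P"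
  unfolding rlat_def using co_lat_root by auto

lemma lat_root_in: "lat_root D c \<in> rlat" by (simp add: rlat_def)

lemma rlat_add: "a \<in> rlat \<Longrightarrow> b \<in> rlat \<Longrightarrow> a + b \<in> rlat"
  and rlat_diff: "a \<in> rlat \<Longrightarrow> b \<in> rlat \<Longrightarrow> a - b \<in> rlat"
  and rlat_smult: "a \<in> rlat \<Longrightarrow> k *s a \<in> rlat"
  unfolding rlat_def
  by (auto simp flip: lat_root_add lat_root_diff lat_root_minus lat_root_smult)

lemma co_add: "a \<in> rlat \<Longrightarrow> b \<in> rlat \<Longrightarrow> co (a + b) = co a + co b"
  and co_diff: "a \<in> rlat \<Longrightarrow> b \<in> rlat \<Longrightarrow> co (a - b) = co a - co b"
  and co_minus: "a \<in> rlat \<Longrightarrow> co (- a) = - co a"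
  and co_smult: "a \<in> rlat \<Longrightarrow> co (k *s a) = k *s co a"
  by (auto elim!: rlatE simp: co_lat_root simp flip: lat_root_add lat_root_diff lat_root_minus
      lat_root_smult lat_coroot_add lat_coroot_diff lat_coroot_minus lat_coroot_smult)

lemma simple_root_in: "\<alpha> i \<in> rlat" and co_simple: "co (\<alpha> i) = \<alpha>v i"
  by (metis lat_root_in lat_root_unit, metis co_lat_root lat_root_unit lat_coroot_unit)

lemma co_sym: "a \<in> rlat \<Longrightarrow> b \<in> rlat \<Longrightarrow> pairing (co a) b = pairing (co b) a"
  by (metis rlatE pairing_lat gcm_form_sym)

lemma W_lattice: "w \<in> W \<Longrightarrow> \<beta> \<in> rlat \<Longrightarrow> dual_act w \<beta> \<in> rlat \<and> w (co \<beta>) = co (dual_act w \<beta>)"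
proof (induction rule: W_induct)
  case id
  then show ?case by (metis dual_act_id id_apply)
next
  case (step w i)
  define \<gamma> where "\<gamma> = dual_act w \<beta>"
  have g: "\<gamma> \<in> rlat" and wg: "w (co \<beta>) = co \<gamma>" using step by (auto simp: \<gamma>_def)
  have 1: "dual_act (sr i \<circ> w) \<beta> = \<gamma> - pairing (\<alpha>v i) \<gamma> *s \<alpha> i"
    using step by (simp add: dual_act_comp W_sr dual_act_sr \<gamma>_def)
  have 2: "(sr i \<circ> w) (co \<beta>) = co \<gamma> - pairing (co \<gamma>) (\<alpha> i) *s \<alpha>v i"
    by (simp add: wg simple_reflection_def)
  \<comment> \<open>The symmetry of the Cartan matrix enters here: \<open>sr i\<close> subtracts the
    same multiple of the simple root from \<open>\<gamma>\<close> as of the simple coroot from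
    \<open>co \<gamma>\<close>.\<close>
  have 3: "pairing (co \<gamma>) (\<alpha> i) = pairing (\<alpha>v i) \<gamma>"
    using co_sym[OF g simple_root_in, of i] by (simp add: co_simple)
  show ?case unfolding 1 2 3
    using g by (simp add: co_diff co_smult rlat_diff rlat_smult simple_root_in co_simple)
qed

lemma dual_act_rlat: "w \<in> W \<Longrightarrow> \<beta> \<in> rlat \<Longrightarrow> dual_act w \<beta> \<in> rlat"
  and W_co: "w \<in> W \<Longrightarrow> \<beta> \<in> rlat \<Longrightarrow> w (co \<beta>) = co (dual_act w \<beta>)"
  using W_lattice by auto

lemma root_in: "\<beta> \<in> \<Delta> \<Longrightarrow> \<beta> \<in> rlat"
  unfolding real_roots_def using dual_act_rlat simple_root_in by auto

lemma simple_root_root: "\<alpha> i \<in> \<Delta>"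
  unfolding real_roots_def by (auto intro!: exI[of _ id] exI[of _ i] simp: dual_act_id W_id)

lemma dual_act_root: "w \<in> W \<Longrightarrow> \<beta> \<in> \<Delta> \<Longrightarrow> dual_act w \<beta> \<in> \<Delta>"
  unfolding real_roots_def by (smt (verit, best) W_comp dual_act_comp mem_Collect_eq)

text \<open>Every presentation of \<open>\<beta>\<close> as a Weyl image of a simple root carries
  the simple coroot to \<open>co \<beta>\<close>, so the description in \<open>coroot\<close> does
  not depend on choices.\<close>

lemma coroot_eq: "\<beta> \<in> \<Delta> \<Longrightarrow> coroot D \<beta> = co \<beta>"
  unfolding coroot_def
proof (rule the_equality)
  assume "\<beta> \<in> \<Delta>"
  then obtain w i where "w \<in> W" "\<beta> = dual_act w (\<alpha> i)" unfolding real_roots_def by auto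
  then show "\<exists>w\<in>W. \<exists>i. \<beta> = dual_act w (\<alpha> i) \<and> co \<beta> = w (\<alpha>v i)"
    using W_co[OF _ simple_root_in] co_simple by metis
next
  fix \<gamma> assume "\<exists>w\<in>W. \<exists>i. \<beta> = dual_act w (\<alpha> i) \<and> \<gamma> = w (\<alpha>v i)"
  then show "\<gamma> = co \<beta>" using W_co[OF _ simple_root_in] co_simple by metis
qed

lemma root_norm: "\<beta> \<in> \<Delta> \<Longrightarrow> pairing (co \<beta>) \<beta> = 2"
  unfolding real_roots_def
  using W_co[OF _ simple_root_in, symmetric]
  by (auto simp: pairing_W_dual_act co_simple pairing_simple diag)

lemma root_minus: "\<beta> \<in> \<Delta> \<Longrightarrow> - \<beta> \<in> \<Delta>"
proof -
  assume "\<beta> \<in> \<Delta>"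
  then obtain w i where w: "w \<in> W" "\<beta> = dual_act w (\<alpha> i)" unfolding real_roots_def by auto
  have "dual_act (sr i) (\<alpha> i) = - \<alpha> i"
    by (simp add: dual_act_sr pairing_simple diag vec_eq_iff)
  then have "- \<beta> = dual_act (w \<circ> sr i) (\<alpha> i)"
    using w by (simp add: dual_act_comp W_sr dual_act_minus)
  then show ?thesis unfolding real_roots_def using W_comp[OF w(1) W_sr] by blast
qed

lemma root_minus_iff: "- \<beta> \<in> \<Delta> \<longleftrightarrow> \<beta> \<in> \<Delta>"
  using root_minus by (metis minus_minus)

lemma root_nonzero: "\<beta> \<in> \<Delta> \<Longrightarrow> \<beta> \<noteq> 0"
  using root_norm[of \<beta>] by (auto simp: pairing_zero_right)

definition refl :: "int ^ 'r \<Rightarrow> int ^ 'r \<Rightarrow> int ^ 'r" where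
  "refl \<beta> \<mu> = \<mu> - pairing \<mu> \<beta> *s co \<beta>"

lemma reflection_eq: "\<beta> \<in> \<Delta> \<Longrightarrow> reflection D \<beta> = refl \<beta>"
  by (auto simp: reflection_def refl_def coroot_eq)

lemma refl_dual_act: "w \<in> W \<Longrightarrow> \<beta> \<in> rlat \<Longrightarrow> refl (dual_act w \<beta>) \<circ> w = w \<circ> refl \<beta>"
  by (auto simp: refl_def pairing_W_dual_act W_co zlinear_diff[OF W_zlinear] zlinear_smult[OF W_zlinear])

lemma refl_W: "\<beta> \<in> \<Delta> \<Longrightarrow> refl \<beta> \<in> W"
proof -
  assume "\<beta> \<in> \<Delta>"
  then obtain w i where w: "w \<in> W" "\<beta> = dual_act w (\<alpha> i)" unfolding real_roots_def by auto
  have "refl (\<alpha> i) = sr i" by (auto simp: refl_def simple_reflection_def co_simple)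
  then have "refl \<beta> \<circ> w = w \<circ> sr i" using refl_dual_act[OF w(1) simple_root_in] w(2) by metis
  then have "refl \<beta> = w \<circ> sr i \<circ> inv w"
    by (metis comp_assoc comp_id W_bij bij_is_surj surj_iff w(1))
  then show ?thesis using W_comp W_sr W_inv w(1) by metis
qed

lemma refl_refl: "\<beta> \<in> \<Delta> \<Longrightarrow> refl \<beta> (refl \<beta> \<mu>) = \<mu>"
  using root_norm by (simp add: refl_def pairing_simps vec_eq_iff algebra_simps)

lemma inv_refl: "\<beta> \<in> \<Delta> \<Longrightarrow> inv (refl \<beta>) = refl \<beta>"
  by (rule inv_unique_comp) (auto simp: refl_refl)

lemma dual_act_refl: "\<beta> \<in> \<Delta> \<Longrightarrow> dual_act (refl \<beta>) \<eta> = \<eta> - pairing (co \<beta>) \<eta> *s \<beta>"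
  by (rule dual_act_eqI[OF refl_W])
     (use root_norm in \<open>auto simp: refl_def pairing_simps algebra_simps\<close>)

lemma root_refl: "\<beta> \<in> \<Delta> \<Longrightarrow> \<gamma> \<in> \<Delta> \<Longrightarrow> \<gamma> - pairing (co \<beta>) \<gamma> *s \<beta> \<in> \<Delta>"
  by (metis dual_act_refl dual_act_root refl_W)

lemma rlat_psd: "\<beta> \<in> rlat \<Longrightarrow> pairing (co \<beta>) \<beta> \<ge> 0"
  by (metis rlatE pairing_lat psd)

section \<open>Positive and negative roots\<close>

lemma nonneg_comb_iff: "nonneg_comb D \<eta> \<longleftrightarrow> (\<exists>c. (\<forall>i. c i \<ge> 0) \<and> \<eta> = lat_root D c)"
proof
  assume "nonneg_comb D \<eta>"
  then show "\<exists>c. (\<forall>i. c i \<ge> 0) \<and> \<eta> = lat_root D c" 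
    unfolding nonneg_comb_def lat_root_def by (metis of_nat_0_le_iff)
next
  assume "\<exists>c. (\<forall>i. c i \<ge> 0) \<and> \<eta> = lat_root D c"
  then obtain c where "\<forall>i. c i \<ge> 0" "\<eta> = lat_root D c" by auto
  then show "nonneg_comb D \<eta>" unfolding nonneg_comb_def lat_root_def
    by (intro exI[of _ "\<lambda>i. nat (c i)"]) simp
qed

lemma nonneg_comb_add: "nonneg_comb D a \<Longrightarrow> nonneg_comb D b \<Longrightarrow> nonneg_comb D (a + b)"
proof -
  assume "nonneg_comb D a" "nonneg_comb D b"
  then obtain c e where "\<forall>i. c i \<ge> 0" "a = lat_root D c" "\<forall>i. e i \<ge> 0" "b = lat_root D e"
    unfolding nonneg_comb_iff by auto
  then show ?thesis unfolding nonneg_comb_iff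
    by (intro exI[of _ "\<lambda>i. c i + e i"]) (auto simp: lat_root_add)
qed

lemma nonneg_comb_smult: "nonneg_comb D a \<Longrightarrow> k \<ge> 0 \<Longrightarrow> nonneg_comb D (k *s a)"
proof -
  assume "nonneg_comb D a" "k \<ge> 0"
  then obtain c where "\<forall>i. c i \<ge> 0" "a = lat_root D c"
    unfolding nonneg_comb_iff by auto
  with \<open>k \<ge> 0\<close> show ?thesis unfolding nonneg_comb_iff
    by (intro exI[of _ "\<lambda>i. k * c i"]) (auto simp: lat_root_smult)
qed

lemma nonneg_comb_antisym: "nonneg_comb D a \<Longrightarrow> nonneg_comb D (- a) \<Longrightarrow> a = 0"
proof -
  assume "nonneg_comb D a" "nonneg_comb D (- a)"
  then obtain c e where c: "\<forall>i. c i \<ge> 0" "a = lat_root D c" and e: "\<forall>i. e i \<ge> 0" "- a = lat_root D e"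
    unfolding nonneg_comb_iff by auto
  have "lat_root D c = lat_root D (\<lambda>i. - e i)" using c e by (simp add: lat_root_minus flip: e(2))
  then have "c = (\<lambda>i. - e i)" by (rule inj_lat_root)
  then have "c i = - e i" for i by (rule fun_cong)
  then have "c i = 0" for i using c(1)[rule_format, of i] e(1)[rule_format, of i] by (metis antisym neg_le_0_iff_le)
  then show "a = 0" using c(2) by (simp add: lat_root_def)
qed

lemma nonneg_comb_simple: "nonneg_comb D (\<alpha> i)"
  unfolding nonneg_comb_iff by (intro exI[of _ "unit_at i"]) (auto simp: lat_root_unit)

lemma gcm_form_diff: "gcm_form D (\<lambda>i. a i - b i) c = gcm_form D a c - gcm_form D b c"
  and gcm_form_diff_right: "gcm_form D c (\<lambda>i. a i - b i) = gcm_form D c a - gcm_form D c b"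
  by (simp_all add: gcm_form_def algebra_simps sum.distrib sum_subtractf)

text \<open>Off-diagonal terms occur in equal pairs and diagonal ones carry the factor 2.\<close>

lemma even_gcm_form: "even (gcm_form D c c)"
proof -
  have "even (\<Sum>i\<in>A. \<Sum>j\<in>A. c i * gcm D i j * c j)" for A
  proof (induction A rule: infinite_finite_induct)
    case (insert x F)
    have "(\<Sum>i\<in>F. c i * gcm D i x * c x) = (\<Sum>j\<in>F. c x * gcm D x j * c j)"
      by (intro sum.cong refl) (simp add: symm mult_ac)
    then show ?case using insert by (simp add: sum.distrib diag)
  qed auto
  then show ?thesis by (simp add: gcm_form_def)
qed

text \<open>Splitting a norm-2 vector into its positive and negative parts, both have even norm and
  nonpositive product, so one of them is null.\<close>

lemma root_coeffs:
  assumes "gcm_form D c c = 2" shows "(\<forall>i. c i \<ge> 0) \<or> (\<forall>i. c i \<le> 0)"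
proof -
  define p where "p = (\<lambda>i. max (c i) 0)"
  define n where "n = (\<lambda>i. max (- c i) 0)"
  have c: "c = (\<lambda>i. p i - n i)" by (auto simp: p_def n_def)
  have pn: "gcm_form D p n \<le> 0" unfolding gcm_form_def
  proof (intro sum_nonpos)
    fix i j
    show "p i * gcm D i j * n j \<le> 0"
    proof (cases "i = j")
      case True
      then show ?thesis by (auto simp: p_def n_def max_def)
    next
      case False
      then show ?thesis using offdiag[OF False]
        by (auto simp: p_def n_def max_def intro!: mult_nonpos_nonneg mult_nonneg_nonpos)
          (metis mult_nonneg_nonpos mult_nonpos_nonpos nle_le mult_nonneg_nonpos2 minus_mult_right neg_le_0_iff_le)
    qed
  qed
  have "2 = gcm_form D p p + gcm_form D n n - 2 * gcm_form D p n"
    using assms gcm_form_sym[of n p] unfolding c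
    by (simp add: gcm_form_diff gcm_form_diff_right)
  then have "gcm_form D p p + gcm_form D n n \<le> 2" using pn by linarith
  moreover have "even (gcm_form D p p)" "even (gcm_form D n n)" by (rule even_gcm_form)+
  ultimately have "gcm_form D p p = 0 \<or> gcm_form D n n = 0"
    using psd[of p] psd[of n] by presburger
  then show ?thesis
  proof
    assume "gcm_form D p p = 0"
    from null[OF this] show ?thesis
      by (auto simp: p_def max_def split: if_splits) (smt (verit))+
  next
    assume "gcm_form D n n = 0"
    from null[OF this] show ?thesis
      by (auto simp: n_def max_def split: if_splits) (smt (verit))+
  qed
qed

lemma root_nonneg_or: "\<beta> \<in> \<Delta> \<Longrightarrow> nonneg_comb D \<beta> \<or> nonneg_comb D (- \<beta>)"
proof -
  assume b: "\<beta> \<in> \<Delta>"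
  obtain c where c: "\<beta> = lat_root D c" "co \<beta> = lat_coroot D c" using rlatE[OF root_in[OF b]] .
  have "gcm_form D c c = 2" using root_norm[OF b] c by (simp add: pairing_lat)
  from root_coeffs[OF this] show ?thesis
  proof
    assume "\<forall>i. c i \<ge> 0"
    then show ?thesis unfolding nonneg_comb_iff using c by blast
  next
    assume "\<forall>i. c i \<le> 0"
    then have "nonneg_comb D (- \<beta>)" unfolding nonneg_comb_iff
      by (intro exI[of _ "\<lambda>i. - c i"]) (auto simp: lat_root_minus c)
    then show ?thesis by simp
  qed
qed

lemma pos_root_root: "\<beta> \<in> \<Delta>p \<Longrightarrow> \<beta> \<in> \<Delta>" by (simp add: pos_roots_def)

lemma neg_pos_iff: "\<beta> \<in> \<Delta> \<Longrightarrow> - \<beta> \<in> \<Delta>p \<longleftrightarrow> \<beta> \<notin> \<Delta>p"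
  unfolding pos_roots_def using root_nonneg_or nonneg_comb_antisym root_nonzero root_minus by blast

lemma simple_root_pos: "\<alpha> i \<in> \<Delta>p"
  by (simp add: pos_roots_def simple_root_root nonneg_comb_simple)

text \<open>The norms of \<open>a + b\<close> and \<open>a - b\<close> are 4 plus or minus twice the
  pairing, and neither is negative.\<close>

lemma abs_root_pairing_le:
  assumes "a \<in> rlat" "b \<in> rlat" "pairing (co a) a = 2" "pairing (co b) b = 2"
  shows "\<bar>pairing (co a) b\<bar> \<le> 2"
proof -
  have "pairing (co (a + b)) (a + b) \<ge> 0" "pairing (co (a - b)) (a - b) \<ge> 0"
    using assms by (auto intro!: rlat_psd rlat_add rlat_diff)
  then show ?thesis using assms co_sym[OF assms(1,2)] by (simp add: co_add co_diff pairing_simps)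
qed

text \<open>The pairings with simple coroots are bounded by 2, so there are finitely many roots
  modulo the radical of the form. This gives finiteness of the roots in finite type and a pigeonhole
  argument in affine type.\<close>

lemma root_values_finite: "finite ((\<lambda>\<gamma> i. pairing (\<alpha>v i) \<gamma>) ` \<Delta>)"
proof (rule finite_subset)
  show "(\<lambda>\<gamma> i. pairing (\<alpha>v i) \<gamma>) ` \<Delta> \<subseteq> PiE UNIV (\<lambda>_. {-2..2})"
  proof
    fix f assume "f \<in> (\<lambda>\<gamma> i. pairing (\<alpha>v i) \<gamma>) ` \<Delta>"
    then obtain \<gamma> where g: "\<gamma> \<in> \<Delta>" "f = (\<lambda>i. pairing (\<alpha>v i) \<gamma>)" by auto
    have "\<bar>pairing (\<alpha>v i) \<gamma>\<bar> \<le> 2" for i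
      using abs_root_pairing_le[of "\<alpha> i" \<gamma>] g root_in root_norm simple_root_root simple_root_in
      by (simp add: co_simple[symmetric])
    then show "f \<in> PiE UNIV (\<lambda>_. {-2..2})" using g by (auto simp: abs_le_iff) (smt (verit))+
  qed
qed (intro finite_PiE, auto)

section \<open>Inversions, dominance and length\<close>

lemma pairing_W: "w \<in> W \<Longrightarrow> pairing (w \<mu>) \<gamma> = pairing \<mu> (dual_act (inv w) \<gamma>)"
  by (metis pairing_W_dual_act dual_act_inv(2))

lemma sr_simple: "dual_act (sr i) (\<alpha> i) = - \<alpha> i"
  by (simp add: dual_act_sr pairing_simple diag vec_eq_iff)

lemma pos_notin_neg: "\<beta> \<in> \<Delta>p \<Longrightarrow> - \<beta> \<notin> \<Delta>p"
  using neg_pos_iff pos_root_root by blast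

text \<open>Only the coefficient at \<open>\<alpha> i\<close> changes. If the image were negative,
  all other coefficients of \<open>\<gamma>\<close> would vanish, and norm 2 would leave only
  \<open>\<gamma> = \<alpha> i\<close>.\<close>

lemma sr_pos:
  assumes "\<gamma> \<in> \<Delta>p" "\<gamma> \<noteq> \<alpha> i" shows "dual_act (sr i) \<gamma> \<in> \<Delta>p"
proof (rule ccontr)
  assume neg: "dual_act (sr i) \<gamma> \<notin> \<Delta>p"
  have g: "\<gamma> \<in> \<Delta>" using assms pos_root_root by auto
  then have "dual_act (sr i) \<gamma> \<in> \<Delta>" by (simp add: dual_act_root W_sr)
  with neg have "nonneg_comb D (- dual_act (sr i) \<gamma>)"
    using neg_pos_iff by (auto simp: pos_roots_def)
  then obtain e where e: "\<forall>j. e j \<ge> 0" "- dual_act (sr i) \<gamma> = lat_root D e"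
    unfolding nonneg_comb_iff by auto
  obtain c where c: "\<forall>j. c j \<ge> 0" "\<gamma> = lat_root D c"
    using assms unfolding pos_roots_def nonneg_comb_iff by auto
  define k where "k = pairing (\<alpha>v i) \<gamma>"
  have "lat_root D (\<lambda>j. c j - k * unit_at i j) = lat_root D (\<lambda>j. - e j)"
    using e(2) c(2) by (simp add: lat_root_diff lat_root_smult lat_root_unit lat_root_minus dual_act_sr k_def
        flip: e(2))
  then have eq: "c j - k * unit_at i j = - e j" for j using inj_lat_root by metis
  have z: "c j = 0" if "j \<noteq> i" for j
    using eq[of j] c(1)[rule_format, of j] e(1)[rule_format, of j] that by simp
  then have "c = (\<lambda>j. c i * unit_at i j)" by auto
  then have gm: "\<gamma> = c i *s \<alpha> i" using c(2) by (metis lat_root_smult lat_root_unit)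
  have "pairing (co \<gamma>) \<gamma> = 2 * (c i * c i)"
    unfolding gm by (simp add: co_smult simple_root_in co_simple pairing_simps pairing_simple diag)
  then have "c i * c i = 1" using root_norm[OF g] by simp
  then have "c i = 1" using c(1)[rule_format, of i] by (auto simp: zmult_eq_1_iff)
  then show False using gm assms(2) by simp
qed

lemma sr_pos_iff:
  assumes "\<delta> \<in> \<Delta>" "\<delta> \<noteq> \<alpha> i" "\<delta> \<noteq> - \<alpha> i"
  shows "dual_act (sr i) \<delta> \<in> \<Delta>p \<longleftrightarrow> \<delta> \<in> \<Delta>p"
  using sr_pos[of \<delta> i] sr_pos[of "- \<delta>" i] assms neg_pos_iff
  by (metis W_sr dual_act_minus dual_act_root minus_minus pos_notin_neg)

lemma Inv_iff: "w \<in> W \<Longrightarrow> \<gamma> \<in> Inv D w \<longleftrightarrow> \<gamma> \<in> \<Delta>p \<and> dual_act w \<gamma> \<notin> \<Delta>p"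
  unfolding Inv_def using neg_pos_iff dual_act_root pos_root_root by blast

text \<open>Since \<open>sr i\<close> permutes the positive roots other than
  \<open>\<alpha> i\<close>, composing with it can only affect the roots that \<open>w\<close> sends
  to \<open>\<alpha> i\<close> or its negative.\<close>

lemma Inv_step:
  assumes w: "w \<in> W" and b: "\<beta> = dual_act (inv w) (\<alpha> i)"
  shows "\<beta> \<in> \<Delta>p \<Longrightarrow> Inv D (sr i \<circ> w) = insert \<beta> (Inv D w) \<and> \<beta> \<notin> Inv D w"
    and "\<beta> \<notin> \<Delta>p \<Longrightarrow> Inv D w = insert (- \<beta>) (Inv D (sr i \<circ> w)) \<and> - \<beta> \<notin> Inv D (sr i \<circ> w)"
proof -
  have wb: "dual_act w \<gamma> = \<alpha> i \<longleftrightarrow> \<gamma> = \<beta>" "dual_act w \<gamma> = - \<alpha> i \<longleftrightarrow> \<gamma> = - \<beta>" for \<gamma>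
    unfolding b using w by (metis dual_act_inv, metis dual_act_inv dual_act_minus W_inv)
  have bD: "\<beta> \<in> \<Delta>" unfolding b using w W_inv dual_act_root simple_root_root by auto
  have 1: "\<gamma> \<in> Inv D (sr i \<circ> w) \<longleftrightarrow> \<gamma> \<in> Inv D w" if "\<gamma> \<noteq> \<beta>" "\<gamma> \<noteq> - \<beta>" for \<gamma>
    using that w wb sr_pos_iff[of "dual_act w \<gamma>" i]
    by (auto simp: Inv_iff W_step dual_act_comp W_sr dual_act_root pos_root_root)
  have 2: "\<beta> \<in> Inv D (sr i \<circ> w) \<longleftrightarrow> \<beta> \<in> \<Delta>p" "\<beta> \<notin> Inv D w"
    "- \<beta> \<notin> Inv D (sr i \<circ> w)" "- \<beta> \<in> Inv D w \<longleftrightarrow> - \<beta> \<in> \<Delta>p"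
    using w wb[of \<beta>] wb[of "- \<beta>"] simple_root_pos[of i] pos_notin_neg[OF simple_root_pos, of i]
    by (auto simp: Inv_iff W_step dual_act_comp W_sr sr_simple dual_act_minus)
  have 3: "- \<beta> \<in> \<Delta>p \<longleftrightarrow> \<beta> \<notin> \<Delta>p" using neg_pos_iff[OF bD] .
  have 4: "- \<beta> \<in> Inv D w \<longleftrightarrow> \<beta> \<notin> \<Delta>p" using 2 3 by simp
  show "\<beta> \<in> \<Delta>p \<Longrightarrow> Inv D (sr i \<circ> w) = insert \<beta> (Inv D w) \<and> \<beta> \<notin> Inv D w"
  proof -
    assume b: "\<beta> \<in> \<Delta>p"
    have "\<gamma> \<in> Inv D (sr i \<circ> w) \<longleftrightarrow> \<gamma> = \<beta> \<or> \<gamma> \<in> Inv D w" for \<gamma>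
      using 1[of \<gamma>] 2 4 b by metis
    then show ?thesis using 2(2) by blast
  qed
  show "\<beta> \<notin> \<Delta>p \<Longrightarrow> Inv D w = insert (- \<beta>) (Inv D (sr i \<circ> w)) \<and> - \<beta> \<notin> Inv D (sr i \<circ> w)"
  proof -
    assume b: "\<beta> \<notin> \<Delta>p"
    have "\<gamma> \<in> Inv D w \<longleftrightarrow> \<gamma> = - \<beta> \<or> \<gamma> \<in> Inv D (sr i \<circ> w)" for \<gamma>
      using 1[of \<gamma>] 2 4 b by metis
    then show ?thesis using 2(3) by blast
  qed
qed

lemma finite_Inv: "w \<in> W \<Longrightarrow> finite (Inv D w)"
proof (induction rule: W_induct)
  case id
  have "Inv D id = {}" using W_id by (auto simp only: Inv_iff dual_act_id)
  then show ?case by (metis finite.emptyI)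
next
  case (step w i)
  then show ?case using Inv_step[OF step(1) refl, of i] by (metis finite_insert)
qed

text \<open>The dual form of the classical fact that \<open>\<rho>\<close> minus its image under the
  inverse of \<open>w\<close> is the sum of the roots inverted by \<open>w\<close>. Each simple
  reflection changes the left side by \<open>pairing \<mu> \<beta>\<close>, and by
  \<open>Inv_step\<close> it either adds \<open>\<beta>\<close> to the inversions or removes
  \<open>- \<beta>\<close>.\<close>

lemma rho_Inv:
  assumes \<rho>: "\<And>i. real_pairing (\<alpha>v i) \<rho> = 1"
  shows "w \<in> W \<Longrightarrow> real_pairing (\<mu> - w \<mu>) \<rho> = of_int (\<Sum>\<gamma>\<in>Inv D w. pairing \<mu> \<gamma>)"
proof (induction rule: W_induct)
  case id
  have "Inv D id = {}" using W_id by (auto simp only: Inv_iff dual_act_id)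
  moreover have "real_pairing (\<mu> - \<mu>) \<rho> = 0" by (simp add: real_pairing_def)
  ultimately show ?case by (metis id_apply sum.empty of_int_0)
next
  case (step w i)
  define \<beta> where "\<beta> = dual_act (inv w) (\<alpha> i)"
  have "pairing (w \<mu>) (\<alpha> i) = pairing \<mu> \<beta>"
    using step(1) by (simp add: pairing_W \<beta>_def)
  then have "\<mu> - (sr i \<circ> w) \<mu> = (\<mu> - w \<mu>) + pairing \<mu> \<beta> *s \<alpha>v i"
    by (simp add: simple_reflection_def)
  then have eq: "real_pairing (\<mu> - (sr i \<circ> w) \<mu>) \<rho> = of_int ((\<Sum>\<gamma>\<in>Inv D w. pairing \<mu> \<gamma>) + pairing \<mu> \<beta>)"
    using step(2) by (simp only: real_pairing_add_left real_pairing_smult_left \<rho> of_int_add)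
  show ?case
  proof (cases "\<beta> \<in> \<Delta>p")
    case True
    then have "Inv D (sr i \<circ> w) = insert \<beta> (Inv D w)" "\<beta> \<notin> Inv D w"
      using Inv_step(1)[OF step(1) \<beta>_def] by blast+
    then have "(\<Sum>\<gamma>\<in>Inv D (sr i \<circ> w). pairing \<mu> \<gamma>) = (\<Sum>\<gamma>\<in>Inv D w. pairing \<mu> \<gamma>) + pairing \<mu> \<beta>"
      using finite_Inv[OF step(1)] by (metis sum.insert add.commute)
    then show ?thesis using eq by metis
  next
    case False
    then have 1: "Inv D w = insert (- \<beta>) (Inv D (sr i \<circ> w))" "- \<beta> \<notin> Inv D (sr i \<circ> w)"
      using Inv_step(2)[OF step(1) \<beta>_def] by blast+
    have "(\<Sum>\<gamma>\<in>Inv D w. pairing \<mu> \<gamma>) = pairing \<mu> (- \<beta>) + (\<Sum>\<gamma>\<in>Inv D (sr i \<circ> w). pairing \<mu> \<gamma>)"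
      using finite_Inv[OF W_step[OF step(1)]] 1 by (metis sum.insert)
    then have "(\<Sum>\<gamma>\<in>Inv D (sr i \<circ> w). pairing \<mu> \<gamma>) = (\<Sum>\<gamma>\<in>Inv D w. pairing \<mu> \<gamma>) + pairing \<mu> \<beta>"
      by (simp only: pairing_minus_right)
    then show ?thesis using eq by metis
  qed
qed

lemma dominant_pos: "dominant D \<nu> \<Longrightarrow> \<gamma> \<in> \<Delta>p \<Longrightarrow> pairing \<nu> \<gamma> \<ge> 0"
  unfolding dominant_def pos_roots_def nonneg_comb_iff
  by (auto simp: lat_root_def pairing_sum_right pairing_simps intro!: sum_nonneg)

section \<open>Words, exchange, and uniqueness of the dominant representative\<close>

definition word :: "'i list \<Rightarrow> int ^ 'r \<Rightarrow> int ^ 'r" where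
  "word L = foldr (\<lambda>i w. sr i \<circ> w) L id"

lemma word_Nil: "word [] = id" and word_Cons: "word (i # L) = sr i \<circ> word L"
  by (simp_all add: word_def)

lemma word_W: "word L \<in> W"
  by (induction L) (simp_all only: word_Nil word_Cons W_id W_step not_False_eq_True)

lemma word_snoc: "word (L @ [i]) = word L \<circ> sr i"
  by (induction L) (simp_all add: word_Nil word_Cons comp_assoc)

lemma W_word: "w \<in> W \<Longrightarrow> \<exists>L. w = word L"
  by (induction rule: W_induct) (metis word_Nil, metis word_Cons)

text \<open>Apply the letters from the right to \<open>\<alpha> i\<close>. At the letter
  \<open>j\<close> where the image turns negative it must equal \<open>\<alpha> j\<close>, so this
  letter conjugates through the later part of the word into \<open>sr i\<close>.\<close>

lemma exchange:
  "dual_act (word L) (- \<alpha> i) \<in> \<Delta>p \<Longrightarrow> \<exists>L'. length L = Suc (length L') \<and> word L = word L' \<circ> sr i"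
proof (induction L)
  case Nil
  then show ?case using pos_notin_neg[OF simple_root_pos] dual_act_id word_Nil by metis
next
  case (Cons j L)
  show ?case
  proof (cases "dual_act (word L) (- \<alpha> i) \<in> \<Delta>p")
    case True
    then obtain L' where "length L = Suc (length L')" "word L = word L' \<circ> sr i" using Cons.IH by blast
    then show ?thesis
      by (intro exI[of _ "j # L'"]) (metis length_Cons word_Cons comp_assoc)
  next
    case False
    define \<delta> where "\<delta> = dual_act (word L) (\<alpha> i)"
    have d: "\<delta> \<in> \<Delta>" unfolding \<delta>_def by (simp add: dual_act_root word_W simple_root_root)
    have "\<delta> \<in> \<Delta>p" using False d neg_pos_iff by (auto simp: \<delta>_def dual_act_minus word_W)
    moreover have "- dual_act (sr j) \<delta> \<in> \<Delta>p"
      using Cons.prems dual_act_comp[OF W_sr word_W, of j L]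
      by (metis W_sr \<delta>_def dual_act_minus word_Cons word_W)
    ultimately have "\<delta> = \<alpha> j" using sr_pos[of \<delta> j] pos_notin_neg by blast
    moreover have "refl (\<alpha> k) = sr k" for k
      by (auto simp: refl_def simple_reflection_def co_simple)
    ultimately have "sr j \<circ> word L = word L \<circ> sr i"
      using refl_dual_act[OF word_W[of L] simple_root_in[of i]] by (metis \<delta>_def)
    then show ?thesis by (intro exI[of _ L]) (metis length_Cons word_Cons)
  qed
qed

text \<open>This is the uniqueness of the dominant element of an orbit: the last letter of the word
  either fixes \<open>\<nu>\<close> or, by the exchange property, can be cancelled.\<close>

lemma dominant_word_fixed:
  "dominant D \<nu> \<Longrightarrow> dominant D (word L \<nu>) \<Longrightarrow> word L \<nu> = \<nu>"
proof (induction "length L" arbitrary: L rule: less_induct)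
  case less
  show ?case
  proof (cases L rule: rev_cases)
    case Nil
    then show ?thesis by (simp add: word_Nil)
  next
    case (snoc M i)
    have wL: "word L = word M \<circ> sr i" by (simp add: snoc word_snoc)
    show ?thesis
    proof (cases "dual_act (word L) (- \<alpha> i) \<in> \<Delta>p")
      case True
      then have "pairing (word L \<nu>) (dual_act (word L) (- \<alpha> i)) \<ge> 0"
        using less.prems dominant_pos by blast
      then have "pairing \<nu> (\<alpha> i) = 0"
        using less.prems(1) by (simp add: pairing_W_dual_act word_W pairing_simps dominant_def antisym)
      then have "word L \<nu> = word M \<nu>" by (simp add: wL simple_reflection_def)
      then show ?thesis using less snoc by simp
    next
      case False
      then have "dual_act (word L) (\<alpha> i) \<in> \<Delta>p"
        by (metis dual_act_minus dual_act_root neg_pos_iff simple_root_root word_W)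
      then have "dual_act (word M) (- \<alpha> i) \<in> \<Delta>p"
        by (simp add: wL dual_act_comp word_W W_sr sr_simple)
      then obtain M' where "length M = Suc (length M')" "word M = word M' \<circ> sr i"
        using exchange by blast
      then have "word L = word M'" "length M' < length L"
        by (metis wL comp_assoc sr_comp comp_id, simp add: snoc \<open>length M = _\<close>)
      then show ?thesis using less by metis
    qed
  qed
qed

lemma dominant_rep_eq:
  assumes "v \<in> W" "dominant D (v \<mu>)" shows "dominant_rep D \<mu> = v \<mu>"
  unfolding dominant_rep_def
proof (rule the_equality)
  show "dominant D (v \<mu>) \<and> (\<exists>w\<in>W. v \<mu> = w \<mu>)" using assms by auto
next
  fix \<nu> assume n: "dominant D \<nu> \<and> (\<exists>w\<in>W. \<nu> = w \<mu>)"
  then obtain w where w: "w \<in> W" "\<nu> = w \<mu>" by auto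
  obtain L where L: "w \<circ> inv v = word L" using W_comp[OF w(1) W_inv[OF assms(1)]] W_word by metis
  have "word L (v \<mu>) = \<nu>" using w assms(1) by (simp flip: L add: inv_W_simps)
  then show "\<nu> = v \<mu>" using dominant_word_fixed[OF assms(2)] n by metis
qed

text \<open>\<open>base_threshold \<gamma>\<close> and \<open>threshold x \<gamma>\<close> are the least \<open>n\<close> for which \<open>\<gamma> + n\<pi>\<close>,
  respectively \<open>x\<^sup>-\<^sup>1(\<gamma> + n\<pi>)\<close>, is positive.\<close>

definition base_threshold :: "int ^ 'r \<Rightarrow> int" where "base_threshold \<gamma> = (if \<gamma> \<in> \<Delta>p then 0 else 1)"

definition threshold :: "'r waff \<Rightarrow> int ^ 'r \<Rightarrow> int" where
  "threshold x \<gamma> = pairing (fst x) \<gamma> + base_threshold (dual_act (inv (snd x)) \<gamma>)"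

section \<open>The length as a sum over thresholds\<close>

lemma tits_negative_Inv:
  assumes "v \<in> W" "dominant D (v \<mu>)" "\<gamma> \<in> \<Delta>p" "pairing \<mu> \<gamma> < 0"
  shows "\<gamma> \<in> Inv D v"
  using assms dominant_pos[OF assms(2), of "dual_act v \<gamma>"]
  by (auto simp: Inv_iff pairing_W_dual_act)

lemma finite_negative: "\<mu> \<in> tits_cone D \<Longrightarrow> finite {\<gamma>\<in>\<Delta>p. pairing \<mu> \<gamma> < 0}"
proof -
  assume "\<mu> \<in> tits_cone D"
  then obtain v where v: "v \<in> W" "dominant D (v \<mu>)" by (auto simp: tits_cone_def)
  have "{\<gamma>\<in>\<Delta>p. pairing \<mu> \<gamma> < 0} \<subseteq> Inv D v" using tits_negative_Inv[OF v] by auto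
  then show ?thesis using finite_Inv[OF v(1)] finite_subset by blast
qed

text \<open>If \<open>v \<mu>\<close> is dominant, the roots inverted by \<open>v\<close> are those
  pairing negatively with \<open>\<mu>\<close>, together with some pairing to 0, so
  \<open>rho_Inv\<close> computes the change of height. The summand vanishes on nonnegative
  pairings; hence \<open>F\<close> may be enlarged freely, which later allows one set for two
  elements.\<close>

lemma two_ht_dominant_rep:
  assumes \<rho>: "\<And>i. real_pairing (\<alpha>v i) \<rho> = 1" and "\<mu> \<in> tits_cone D"
    and F: "finite F" "F \<subseteq> \<Delta>p" "{\<gamma>\<in>\<Delta>p. pairing \<mu> \<gamma> < 0} \<subseteq> F"
  shows "two_ht \<rho> (dominant_rep D \<mu>) = two_ht \<rho> \<mu> + (\<Sum>\<gamma>\<in>F. \<bar>pairing \<mu> \<gamma>\<bar> - pairing \<mu> \<gamma>)"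
proof -
  obtain v where v: "v \<in> W" "dominant D (v \<mu>)" using assms(2) by (auto simp: tits_cone_def)
  let ?N = "{\<gamma>\<in>\<Delta>p. pairing \<mu> \<gamma> < 0}"
  have np: "pairing \<mu> \<gamma> \<le> 0" if "\<gamma> \<in> Inv D v" for \<gamma>
  proof -
    have "- dual_act v \<gamma> \<in> \<Delta>p" using that by (simp add: Inv_def)
    from dominant_pos[OF v(2) this] show ?thesis
      by (simp add: pairing_simps pairing_W_dual_act v)
  qed
  have "(\<Sum>\<gamma>\<in>Inv D v. pairing \<mu> \<gamma>) = (\<Sum>\<gamma>\<in>?N. pairing \<mu> \<gamma>)"
    using tits_negative_Inv[OF v] np finite_Inv[OF v(1)]
    by (intro sum.mono_neutral_right) (force simp: Inv_def)+
  then have "2 * real_pairing (\<mu> - v \<mu>) \<rho> = of_int (2 * (\<Sum>\<gamma>\<in>?N. pairing \<mu> \<gamma>))"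
    using rho_Inv[OF \<rho> v(1), of \<mu>] by (metis of_int_mult of_int_numeral)
  from two_ht_diff[OF this, of \<mu>]
  have 1: "two_ht \<rho> (v \<mu>) = two_ht \<rho> \<mu> - 2 * (\<Sum>\<gamma>\<in>?N. pairing \<mu> \<gamma>)" by simp
  have "(\<Sum>\<gamma>\<in>F. \<bar>pairing \<mu> \<gamma>\<bar> - pairing \<mu> \<gamma>) = (\<Sum>\<gamma>\<in>?N. \<bar>pairing \<mu> \<gamma>\<bar> - pairing \<mu> \<gamma>)"
    using F by (intro sum.mono_neutral_right) auto
  also have "\<dots> = (\<Sum>\<gamma>\<in>?N. - 2 * pairing \<mu> \<gamma>)" by (intro sum.cong) auto
  finally show ?thesis using 1 dominant_rep_eq[OF v] by (simp add: sum_distrib_left sum_negf)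
qed

text \<open>For a positive root with pairing \<open>p\<close>, the threshold is \<open>p + 1\<close>
  at an inversion and \<open>p\<close> otherwise. Since
  \<open>\<bar>p + 1\<bar> - \<bar>p\<bar>\<close> is 1 for \<open>p \<ge> 0\<close> and -1 for
  \<open>p < 0\<close>, the signed count in \<open>len\<close> is the sum of
  \<open>\<bar>threshold\<bar> - \<bar>pairing\<bar>\<close>; the height term supplies the
  rest.\<close>

lemma len_eq:
  assumes \<rho>: "\<And>i. real_pairing (\<alpha>v i) \<rho> = 1" and x: "x \<in> W_T D"
    and F: "finite F" "F \<subseteq> \<Delta>p" "{\<gamma>\<in>\<Delta>p. pairing (fst x) \<gamma> < 0} \<subseteq> F" "Inv D (inv (snd x)) \<subseteq> F"
  shows "len D \<rho> x = two_ht \<rho> (fst x) + (\<Sum>\<gamma>\<in>F. \<bar>threshold x \<gamma>\<bar> - pairing (fst x) \<gamma>)"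
proof -
  obtain \<mu> w where xw: "x = (\<mu>, w)" by (cases x)
  have w: "w \<in> W" and mu: "\<mu> \<in> tits_cone D" using x by (auto simp: W_T_def xw)
  let ?I = "Inv D (inv w)"
  have fI: "finite ?I" using finite_Inv W_inv w by auto
  have "int (card {\<gamma> \<in> ?I. pairing \<mu> \<gamma> \<ge> 0}) - int (card {\<gamma> \<in> ?I. pairing \<mu> \<gamma> < 0})
      = (\<Sum>\<gamma>\<in>?I. if pairing \<mu> \<gamma> \<ge> 0 then 1 else - 1)"
    using fI by (simp add: sum.If_cases Int_def not_le)
  also have "\<dots> = (\<Sum>\<gamma>\<in>F. \<bar>threshold x \<gamma>\<bar> - \<bar>pairing \<mu> \<gamma>\<bar>)"
    using F w W_inv[OF w] by (intro sum.mono_neutral_cong_left) (auto simp: xw threshold_def base_threshold_def Inv_iff)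
  finally show ?thesis
    using two_ht_dominant_rep[OF \<rho> mu F(1,2)] F(3)
    by (simp add: xw len_def sum_subtractf)
qed

section \<open>The length increase along a reflection\<close>

text \<open>The affine reflection of the coweight lattice whose fixed hyperplane is
  \<open>pairing \<mu> \<gamma> = n\<close>.\<close>

definition trefl :: "int ^ 'r \<Rightarrow> int \<Rightarrow> int ^ 'r \<Rightarrow> int ^ 'r" where
  "trefl \<gamma> n \<mu> = \<mu> - (pairing \<mu> \<gamma> - n) *s co \<gamma>"

text \<open>Left multiplication by the reflection in \<open>\<gamma> + n\<pi>\<close>. Working on
  the left keeps the root fixed while its positivity is compared before and after applying the
  inverse of \<open>x\<close>.\<close>

definition lrefl :: "int ^ 'r \<Rightarrow> int \<Rightarrow> 'r waff \<Rightarrow> 'r waff" where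
  "lrefl \<gamma> n x = (trefl \<gamma> n (fst x), refl \<gamma> \<circ> snd x)"

definition apos :: "int ^ 'r \<Rightarrow> int \<Rightarrow> bool" where
  "apos \<gamma> n \<longleftrightarrow> aroot_pos D (\<gamma>, n)"

text \<open>Positivity of the image of \<open>\<gamma> + n\<pi>\<close> under the inverse of
  \<open>x\<close>, which subtracts the pairing with the translation part of \<open>x\<close> from
  \<open>n\<close>.\<close>

definition xpos :: "'r waff \<Rightarrow> int ^ 'r \<Rightarrow> int \<Rightarrow> bool" where
  "xpos x \<gamma> n \<longleftrightarrow> apos (dual_act (inv (snd x)) \<gamma>) (n - pairing (fst x) \<gamma>)"

lemma apos_iff: "\<gamma> \<in> \<Delta> \<Longrightarrow> apos \<gamma> n \<longleftrightarrow> n \<ge> base_threshold \<gamma>"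
  using neg_pos_iff by (auto simp: apos_def aroot_pos_def base_threshold_def)

lemma W_T_snd: "x \<in> W_T D \<Longrightarrow> snd x \<in> W"
  and W_T_fst: "x \<in> W_T D \<Longrightarrow> fst x \<in> tits_cone D"
  by (auto simp: W_T_def)

lemma dual_act_inv_root: "w \<in> W \<Longrightarrow> \<gamma> \<in> \<Delta> \<Longrightarrow> dual_act (inv w) \<gamma> \<in> \<Delta>"
  by (simp add: W_inv dual_act_root)

lemma xpos_iff: "snd x \<in> W \<Longrightarrow> \<gamma> \<in> \<Delta> \<Longrightarrow> xpos x \<gamma> n \<longleftrightarrow> n \<ge> threshold x \<gamma>"
  by (auto simp: xpos_def apos_iff dual_act_inv_root threshold_def)

lemma base_threshold_minus: "\<gamma> \<in> \<Delta> \<Longrightarrow> base_threshold (- \<gamma>) = 1 - base_threshold \<gamma>"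
  using neg_pos_iff by (auto simp: base_threshold_def)

lemma threshold_minus: "snd x \<in> W \<Longrightarrow> \<gamma> \<in> \<Delta> \<Longrightarrow> threshold x (- \<gamma>) = 1 - threshold x \<gamma>"
  by (simp add: threshold_def pairing_simps dual_act_minus W_inv base_threshold_minus dual_act_inv_root)

lemma apos_minus: "\<gamma> \<in> \<Delta> \<Longrightarrow> apos (- \<gamma>) (- n) \<longleftrightarrow> \<not> apos \<gamma> n"
  by (auto simp: apos_iff root_minus base_threshold_minus)

lemma xpos_minus: "snd x \<in> W \<Longrightarrow> \<gamma> \<in> \<Delta> \<Longrightarrow> xpos x (- \<gamma>) (- n) \<longleftrightarrow> \<not> xpos x \<gamma> n"
  by (auto simp: xpos_iff root_minus threshold_minus)

lemma lrefl_minus: "\<gamma> \<in> \<Delta> \<Longrightarrow> lrefl (- \<gamma>) (- n) = lrefl \<gamma> n"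
  by (auto simp: lrefl_def trefl_def refl_def co_minus root_in pairing_simps fun_eq_iff vec_eq_iff algebra_simps)

lemma lrefl_comp_W: "snd x \<in> W \<Longrightarrow> \<gamma> \<in> \<Delta> \<Longrightarrow> snd (lrefl \<gamma> n x) \<in> W"
  by (simp only: lrefl_def snd_conv W_comp refl_W)

lemma dual_act_inv_refl_comp:
  assumes "w \<in> W" "\<gamma> \<in> \<Delta>"
  shows "dual_act (inv (refl \<gamma> \<circ> w)) \<beta> = dual_act (inv w) (\<beta> - pairing (co \<gamma>) \<beta> *s \<gamma>)"
proof -
  have "inv (refl \<gamma> \<circ> w) = inv w \<circ> refl \<gamma>"
    using o_inv_distrib[OF W_bij[OF refl_W[OF assms(2)]] W_bij[OF assms(1)]] inv_refl[OF assms(2)]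
    by metis
  then have "dual_act (inv (refl \<gamma> \<circ> w)) \<beta> = dual_act (inv w) (dual_act (refl \<gamma>) \<beta>)"
    using dual_act_comp[OF W_inv[OF assms(1)] refl_W[OF assms(2)]] by metis
  then show ?thesis using dual_act_refl[OF assms(2)] by metis
qed

lemma xpos_lrefl:
  assumes "snd x \<in> W" "\<gamma> \<in> \<Delta>"
  shows "xpos (lrefl \<gamma> n x) \<beta> l \<longleftrightarrow>
    xpos x (\<beta> - pairing (co \<gamma>) \<beta> *s \<gamma>) (l - pairing (co \<gamma>) \<beta> * n)"
  using dual_act_inv_refl_comp[OF assms, of \<beta>]
  by (simp only: xpos_def lrefl_def fst_conv snd_conv) (simp add: trefl_def pairing_simps algebra_simps)

lemma threshold_lrefl:
  assumes "snd x \<in> W" "\<gamma> \<in> \<Delta>"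
  shows "threshold (lrefl \<gamma> n x) \<beta> = threshold x (\<beta> - pairing (co \<gamma>) \<beta> *s \<gamma>) + pairing (co \<gamma>) \<beta> * n"
  using dual_act_inv_refl_comp[OF assms, of \<beta>]
  by (simp only: threshold_def lrefl_def fst_conv snd_conv) (simp add: trefl_def pairing_simps algebra_simps)

lemma wmult_areflection:
  assumes "snd x \<in> W" "\<beta> \<in> \<Delta>" "\<eta> = dual_act (snd x) \<beta>" 
  shows "wmult x (areflection D \<beta> n) = lrefl \<eta> (n + pairing (fst x) \<eta>) x"
proof -
  have "snd x \<circ> refl \<beta> = refl \<eta> \<circ> snd x" using refl_dual_act[OF assms(1) root_in[OF assms(2)]] assms(3) by metis
  moreover have "snd x (n *s co \<beta>) = n *s co \<eta>"
    using assms by (simp add: zlinear_smult[OF W_zlinear] W_co root_in)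
  ultimately show ?thesis
    by (simp only: wmult_def areflection_def fst_conv snd_conv lrefl_def trefl_def
        coroot_eq[OF assms(2)] reflection_eq[OF assms(2)]) (simp add: vec_eq_iff)
qed

text \<open>Right multiplication by the reflection in \<open>r\<close> is left multiplication by the
  reflection in \<open>x r\<close>. With \<open>\<eta> + m\<pi> = x r\<close>, the Bruhat condition
  \<open>x r > 0\<close> reads \<open>apos\<close> and the normalization \<open>r > 0\<close> reads
  \<open>xpos\<close>, which removes the sign convention in \<open>aroot_of\<close>.\<close>

lemma bruhat_step_iff:
  "bruhat_step D x y \<longleftrightarrow> x \<in> W_T D \<and> y \<in> W_T D \<and>
     (\<exists>\<eta>\<in>\<Delta>. \<exists>m. apos \<eta> m \<and> xpos x \<eta> m \<and> y = lrefl \<eta> m x)" (is "_ \<longleftrightarrow> _ \<and> _ \<and> ?E")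
proof -
  have "(\<exists>\<beta>\<in>\<Delta>p. \<exists>n. y = wmult x (areflection D \<beta> n) \<and> aroot_pos D (aroot_act x (aroot_of \<beta> n))) \<longleftrightarrow> ?E"
    (is "?L \<longleftrightarrow> _") if x: "x \<in> W_T D"
  proof
    have w: "snd x \<in> W" using x W_T_snd by blast
    have act: "aroot_act x r = (dual_act (snd x) (fst r), snd r + pairing (fst x) (dual_act (snd x) (fst r)))" for r
      by (simp add: aroot_act_def case_prod_beta)
    have xp: "xpos x (dual_act (snd x) \<beta>) (n + pairing (fst x) (dual_act (snd x) \<beta>)) \<longleftrightarrow> apos \<beta> n" for \<beta> n
      using w by (simp add: xpos_def dual_act_inv)
    show "?L \<Longrightarrow> ?E"
    proof -
      assume ?L
      then obtain \<beta> n where b: "\<beta> \<in> \<Delta>p" "y = wmult x (areflection D \<beta> n)"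
        "aroot_pos D (aroot_act x (aroot_of \<beta> n))" by auto
      define \<eta> where "\<eta> = dual_act (snd x) \<beta>"
      have bD: "\<beta> \<in> \<Delta>" "\<eta> \<in> \<Delta>" using b pos_root_root w dual_act_root by (auto simp: \<eta>_def)
      have y: "y = lrefl \<eta> (n + pairing (fst x) \<eta>) x"
        using wmult_areflection[OF w bD(1) \<eta>_def] b by simp
      show ?E
      proof (cases "n \<ge> 0")
        case True
        then show ?thesis using b y bD xp[of \<beta> n]
          by (intro bexI[of _ \<eta>] exI[of _ "n + pairing (fst x) \<eta>"])
            (auto simp: act aroot_of_def \<eta>_def apos_def aroot_pos_def)
      next
        case False
        have "y = lrefl (- \<eta>) (- (n + pairing (fst x) \<eta>)) x" using y lrefl_minus[OF bD(2), of "n + pairing (fst x) \<eta>"] by metis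
        then show ?thesis using False b bD xp[of "- \<beta>" "- n"] w
          by (intro bexI[of _ "- \<eta>"] exI[of _ "- (n + pairing (fst x) \<eta>)"])
            (auto simp: act aroot_of_def \<eta>_def apos_def aroot_pos_def dual_act_minus pairing_simps root_minus)
      qed
    qed
    show "?E \<Longrightarrow> ?L"
    proof -
      assume ?E
      then obtain \<eta> m where e: "\<eta> \<in> \<Delta>" "apos \<eta> m" "xpos x \<eta> m" "y = lrefl \<eta> m x" by auto
      define \<beta> where "\<beta> = dual_act (inv (snd x)) \<eta>"
      define n where "n = m - pairing (fst x) \<eta>"
      have bD: "\<beta> \<in> \<Delta>" using e w by (simp add: \<beta>_def dual_act_inv_root)
      have eb: "\<eta> = dual_act (snd x) \<beta>" using w by (simp add: \<beta>_def dual_act_inv)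
      have bp: "apos \<beta> n" using e by (simp add: xpos_def \<beta>_def n_def)
      have ap: "aroot_pos D (aroot_act x (\<beta>, n))" using e by (simp add: act n_def apos_def flip: eb)
      show ?L
      proof (cases "\<beta> \<in> \<Delta>p")
        case True
        then have "n \<ge> 0" using bp bD by (auto simp: apos_iff base_threshold_def)
        then show ?thesis using True ap wmult_areflection[OF w bD eb, of n] e
          by (intro bexI[of _ \<beta>] exI[of _ n]) (auto simp: aroot_of_def n_def)
      next
        case False
        then have n: "n > 0" using bp bD by (auto simp: apos_iff base_threshold_def)
        have "- \<beta> \<in> \<Delta>p" using False bD neg_pos_iff by auto
        moreover have "y = wmult x (areflection D (- \<beta>) (- n))"
          using wmult_areflection[OF w root_minus[OF bD] refl, of "- n"] e w lrefl_minus[OF e(1), of m]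
          by (simp add: dual_act_minus pairing_simps n_def flip: eb)
        ultimately show ?thesis using n ap
          by (intro bexI[of _ "- \<beta>"] exI[of _ "- n"]) (auto simp: aroot_of_def)
      qed
    qed
  qed
  then show ?thesis unfolding bruhat_step_def by blast
qed

text \<open>The root may also be negative on both sides, since a root and its negative give the same
  reflection.\<close>

lemma bruhat_stepI:
  assumes "x \<in> W_T D" "lrefl \<eta> m x \<in> W_T D" "\<eta> \<in> \<Delta>" "apos \<eta> m \<longleftrightarrow> xpos x \<eta> m"
  shows "bruhat_step D x (lrefl \<eta> m x)"
proof (cases "apos \<eta> m")
  case True
  then show ?thesis using assms unfolding bruhat_step_iff by blast
next
  case False
  then have "apos (- \<eta>) (- m)" "xpos x (- \<eta>) (- m)" "lrefl \<eta> m x = lrefl (- \<eta>) (- m) x"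
    using assms by (simp_all add: apos_minus xpos_minus W_T_snd lrefl_minus)
  then show ?thesis using assms root_minus unfolding bruhat_step_iff by blast
qed

text \<open>Puts the endpoints \<open>base_threshold \<gamma>\<close> and
  \<open>c * m + 1 - base_threshold \<gamma>'\<close> in order, as \<open>interval_overlap\<close>
  demands. The only case with content is \<open>m = 0\<close>: then \<open>\<eta>\<close> is
  positive, and two negative roots cannot add up to a positive multiple of it.\<close>

lemma base_threshold_sum_le:
  assumes "\<gamma> \<in> \<Delta>" "\<gamma>' \<in> \<Delta>" "\<eta> \<in> \<Delta>" "\<gamma> + \<gamma>' = c *s \<eta>" "c > 0" "m \<ge> base_threshold \<eta>"
  shows "base_threshold \<gamma> + base_threshold \<gamma>' \<le> c * m + 1"
proof (cases "m \<ge> 1")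
  case True
  then have "c * m \<ge> 1" using assms(5) mult_mono[of 1 c 1 m] by simp
  then show ?thesis by (auto simp: base_threshold_def)
next
  case False
  then have m: "m = 0" "\<eta> \<in> \<Delta>p" using assms(6) by (auto simp: base_threshold_def split: if_splits)
  have "\<gamma> \<in> \<Delta>p \<or> \<gamma>' \<in> \<Delta>p"
  proof (rule ccontr)
    assume "\<not> ?thesis"
    then have "nonneg_comb D (- \<gamma>)" "nonneg_comb D (- \<gamma>')"
      using assms(1,2) neg_pos_iff by (auto simp: pos_roots_def)
    then have "nonneg_comb D (- \<gamma> + - \<gamma>')" by (rule nonneg_comb_add)
    also have "- \<gamma> + - \<gamma>' = - (c *s \<eta>)" using assms(4) by (simp flip: assms(4))
    finally have "c *s \<eta> = 0"
      using nonneg_comb_antisym[of "c *s \<eta>"] nonneg_comb_smult[of \<eta> c] m assms(5) by (auto simp: pos_roots_def)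
    then have "\<eta> = 0" using assms(5) by (auto simp: vec_eq_iff)
    then show False using root_nonzero assms(3) by auto
  qed
  then show ?thesis using m by (auto simp: base_threshold_def)
qed

lemma threshold_sum_le:
  assumes "snd x \<in> W" "\<gamma> \<in> \<Delta>" "\<gamma>' \<in> \<Delta>" "\<eta> \<in> \<Delta>" "\<gamma> + \<gamma>' = c *s \<eta>" "c > 0" "m \<ge> threshold x \<eta>"
  shows "threshold x \<gamma> + threshold x \<gamma>' \<le> c * m + 1"
proof -
  let ?v = "dual_act (inv (snd x))"
  have "base_threshold (?v \<gamma>) + base_threshold (?v \<gamma>') \<le> c * (m - pairing (fst x) \<eta>) + 1"
  proof (rule base_threshold_sum_le)
    show "?v \<gamma> + ?v \<gamma>' = c *s ?v \<eta>"
      using assms by (metis W_inv dual_act_add dual_act_smult)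
  qed (use assms in \<open>auto simp: dual_act_inv_root threshold_def\<close>)
  moreover have "pairing (fst x) \<gamma> + pairing (fst x) \<gamma>' = c * pairing (fst x) \<eta>"
    by (metis assms(5) pairing_add_right pairing_smult_right)
  ultimately show ?thesis by (simp add: threshold_def algebra_simps)
qed

section \<open>Length differences as finite sums over roots\<close>

lemma sum_even_roots:
  fixes h :: "int ^ 'r \<Rightarrow> int"
  assumes S: "finite S" "S \<subseteq> \<Delta>" "\<And>\<gamma>. \<gamma> \<in> S \<Longrightarrow> - \<gamma> \<in> S"
    and h: "\<And>\<gamma>. \<gamma> \<in> S \<Longrightarrow> h (- \<gamma>) = h \<gamma>"
  shows "(\<Sum>\<gamma>\<in>S. h \<gamma>) = 2 * (\<Sum>\<gamma>\<in>S \<inter> \<Delta>p. h \<gamma>)"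
proof -
  have "(\<Sum>\<gamma>\<in>S. h \<gamma>) = (\<Sum>\<gamma>\<in>S \<inter> \<Delta>p. h \<gamma>) + (\<Sum>\<gamma>\<in>S - \<Delta>p. h \<gamma>)"
    using S(1) by (rule sum.Int_Diff)
  also have "(\<Sum>\<gamma>\<in>S - \<Delta>p. h \<gamma>) = (\<Sum>\<gamma>\<in>S \<inter> \<Delta>p. h \<gamma>)"
    by (rule sum.reindex_bij_witness[of _ uminus uminus])
      (use S neg_pos_iff pos_notin_neg in \<open>auto simp: h\<close>)
  finally show ?thesis by simp
qed

text \<open>\<open>rho_Inv\<close> applied to the reflection and to \<open>co \<eta>\<close> itself
  gives the sum over the inversions of the reflection. On the remaining positive roots in
  \<open>S\<close> the reflection is an involution reversing the sign of the pairing, so they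
  contribute 0.\<close>

lemma two_ht_co:
  assumes \<rho>: "\<And>i. real_pairing (\<alpha>v i) \<rho> = 1" and e: "\<eta> \<in> \<Delta>"
    and S: "finite S" "S \<subseteq> \<Delta>" "Inv D (refl \<eta>) \<subseteq> S"
      "\<And>\<gamma>. \<gamma> \<in> S \<Longrightarrow> \<gamma> - pairing (co \<eta>) \<gamma> *s \<eta> \<in> S"
  shows "2 * real_pairing (co \<eta>) \<rho> = of_int (\<Sum>\<gamma>\<in>S \<inter> \<Delta>p. pairing (co \<eta>) \<gamma>)"
proof -
  define s where "s = (\<lambda>\<gamma>. \<gamma> - pairing (co \<eta>) \<gamma> *s \<eta>)"
  let ?c = "pairing (co \<eta>)"
  let ?I = "Inv D (refl \<eta>)"
  have cs: "?c (s \<gamma>) = - ?c \<gamma>" and ss: "s (s \<gamma>) = \<gamma>" for \<gamma>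
    by (simp_all add: s_def pairing_simps root_norm[OF e] vec_eq_iff algebra_simps)
  have S4: "s \<gamma> \<in> S" if "\<gamma> \<in> S" for \<gamma> using S(4)[OF that] by (simp add: s_def)
  have I: "\<gamma> \<in> ?I \<longleftrightarrow> \<gamma> \<in> \<Delta>p \<and> s \<gamma> \<notin> \<Delta>p" for \<gamma>
    by (simp only: Inv_iff[OF refl_W[OF e]] dual_act_refl[OF e] s_def)
  let ?G = "S \<inter> \<Delta>p - ?I"
  have "sum ?c ?G = (\<Sum>\<gamma>\<in>?G. - ?c \<gamma>)"
    by (rule sum.reindex_bij_witness[of _ s s]) (use S4 in \<open>auto simp: I cs ss\<close>)
  then have "sum ?c ?G = 0" by (simp add: sum_negf)
  then have eq: "sum ?c (S \<inter> \<Delta>p) = sum ?c ?I"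
    using S(1,3) I by (subst sum.subset_diff[of ?I]) auto
  have "co \<eta> - refl \<eta> (co \<eta>) = 2 *s co \<eta>" by (simp add: refl_def root_norm[OF e])
  then have "2 * real_pairing (co \<eta>) \<rho> = real_pairing (co \<eta> - refl \<eta> (co \<eta>)) \<rho>"
    by (simp only: real_pairing_smult_left of_int_numeral)
  also have "\<dots> = of_int (sum ?c ?I)" by (rule rho_Inv[OF \<rho> refl_W[OF e]])
  finally show ?thesis using eq by simp
qed

text \<open>Both lengths are expanded by \<open>len_eq\<close> over the same finite set. Closing it
  under the reflection makes \<open>two_ht_co\<close> applicable, and then the change of height
  cancels the change of the summed pairings.\<close>

lemma len_diff_sum:
  assumes \<rho>: "\<And>i. real_pairing (\<alpha>v i) \<rho> = 1" and x: "x \<in> W_T D" and y: "lrefl \<eta> m x \<in> W_T D"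
    and e: "\<eta> \<in> \<Delta>"
  obtains S where "finite S" "S \<subseteq> \<Delta>" "\<eta> \<in> S" "\<And>\<gamma>. \<gamma> \<in> S \<Longrightarrow> - \<gamma> \<in> S"
    "\<And>\<gamma>. \<gamma> \<in> S \<Longrightarrow> \<gamma> - pairing (co \<eta>) \<gamma> *s \<eta> \<in> S"
    "len D \<rho> (lrefl \<eta> m x) - len D \<rho> x = (\<Sum>\<gamma>\<in>S \<inter> \<Delta>p. \<bar>threshold (lrefl \<eta> m x) \<gamma>\<bar> - \<bar>threshold x \<gamma>\<bar>)"
proof -
  define y where "y = lrefl \<eta> m x"
  define s where "s = (\<lambda>\<gamma>. \<gamma> - pairing (co \<eta>) \<gamma> *s \<eta>)"
  have ss: "s (s \<gamma>) = \<gamma>" and sm: "s (- \<gamma>) = - s \<gamma>" for \<gamma>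
    by (simp_all add: s_def pairing_simps root_norm[OF e] vec_eq_iff algebra_simps)
  \<comment> \<open>All roots where the summand of \<open>len_eq\<close> can be nonzero for
    \<open>x\<close> or \<open>y\<close>, the inversions required by \<open>two_ht_co\<close>, and
    \<open>\<eta>\<close> itself.\<close>
  define G where "G = insert \<eta> ({\<gamma>\<in>\<Delta>p. pairing (fst x) \<gamma> < 0} \<union> {\<gamma>\<in>\<Delta>p. pairing (fst y) \<gamma> < 0}
     \<union> Inv D (inv (snd x)) \<union> Inv D (inv (snd y)) \<union> Inv D (refl \<eta>))"
  have w: "snd x \<in> W" "snd y \<in> W" using x y W_T_snd y_def by auto
  have "finite G" unfolding G_def
    using x y W_T_fst finite_negative finite_Inv W_inv w refl_W[OF e] by (auto simp: y_def)
  moreover have "G \<subseteq> \<Delta>" unfolding G_def using e by (auto simp: Inv_def pos_root_root)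
  \<comment> \<open>Negation and \<open>s\<close> are commuting involutions, so four images suffice
    for closure under both.\<close>
  define S where "S = G \<union> uminus ` G \<union> s ` G \<union> s ` uminus ` G"
  have 1: "finite S" using \<open>finite G\<close> by (simp add: S_def)
  have 2: "S \<subseteq> \<Delta>" using \<open>G \<subseteq> \<Delta>\<close> root_minus root_refl[OF e] unfolding S_def s_def by blast
  have 3: "\<eta> \<in> S" by (simp add: S_def G_def)
  have 4: "- \<gamma> \<in> S" if "\<gamma> \<in> S" for \<gamma>
    using that unfolding S_def by (auto simp: image_iff simp flip: sm)
  have 5: "s \<gamma> \<in> S" if "\<gamma> \<in> S" for \<gamma>
    using that unfolding S_def by (auto simp: image_iff ss)
  let ?F = "S \<inter> \<Delta>p"
  have G: "G \<subseteq> S" by (auto simp: S_def)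
  have lx: "len D \<rho> x = two_ht \<rho> (fst x) + (\<Sum>\<gamma>\<in>?F. \<bar>threshold x \<gamma>\<bar> - pairing (fst x) \<gamma>)"
    using 1 G by (intro len_eq \<rho> x) (auto simp: G_def Inv_def)
  have ly: "len D \<rho> y = two_ht \<rho> (fst y) + (\<Sum>\<gamma>\<in>?F. \<bar>threshold y \<gamma>\<bar> - pairing (fst y) \<gamma>)"
    using 1 G y by (intro len_eq \<rho>) (auto simp: G_def Inv_def y_def)
  let ?k = "pairing (fst x) \<eta> - m"
  have fy: "fst y = fst x - ?k *s co \<eta>" by (simp add: y_def lrefl_def trefl_def)
  have "2 * real_pairing (co \<eta>) \<rho> = of_int (\<Sum>\<gamma>\<in>?F. pairing (co \<eta>) \<gamma>)"
    using 5 G by (intro two_ht_co \<rho> e 1 2) (auto simp: G_def s_def)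
  then have "2 * real_pairing (?k *s co \<eta>) \<rho> = of_int (?k * (\<Sum>\<gamma>\<in>?F. pairing (co \<eta>) \<gamma>))"
    by (simp only: real_pairing_smult_left of_int_mult) simp
  from two_ht_diff[OF this, of "fst x"]
  have hy: "two_ht \<rho> (fst y) = two_ht \<rho> (fst x) - ?k * (\<Sum>\<gamma>\<in>?F. pairing (co \<eta>) \<gamma>)" by (simp only: fy)
  have "(\<Sum>\<gamma>\<in>?F. pairing (fst y) \<gamma>) = (\<Sum>\<gamma>\<in>?F. pairing (fst x) \<gamma>) - ?k * (\<Sum>\<gamma>\<in>?F. pairing (co \<eta>) \<gamma>)"
    by (simp only: fy pairing_simps sum_subtractf sum_distrib_left)
  then have "len D \<rho> y - len D \<rho> x = (\<Sum>\<gamma>\<in>?F. \<bar>threshold y \<gamma>\<bar> - \<bar>threshold x \<gamma>\<bar>)"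
    unfolding lx ly hy by (simp add: sum_subtractf)
  then show ?thesis using that[OF 1 2 3 4 5[unfolded s_def]] unfolding y_def by blast
qed

text \<open>Reflecting a pair \<open>\<gamma>, \<gamma>' = -s\<^sub>\<eta>\<gamma>\<close> of roots with \<open>\<langle>\<eta>\<^sup>\<or>, \<gamma>\<rangle> > 0\<close> changes the number of
  inversions in these two directions by twice the number of positive affine roots \<open>\<gamma> + n\<pi>\<close>
  that, together with their mirror image, remain positive under \<open>x\<^sup>-\<^sup>1\<close>.\<close>

definition overlap :: "int ^ 'r \<Rightarrow> int \<Rightarrow> 'r waff \<Rightarrow> int ^ 'r \<Rightarrow> int" where
  "overlap \<eta> m x \<gamma> = (let c = pairing (co \<eta>) \<gamma>; \<gamma>' = c *s \<eta> - \<gamma> in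
     min (c * m + 1 - threshold x \<gamma>') (c * m + 1 - base_threshold \<gamma>') - max (threshold x \<gamma>) (base_threshold \<gamma>))"

text \<open>Evenness under negation allows summing over all of \<open>S\<close>, and averaging over
  the reflection groups \<open>\<gamma>\<close> with its mirror image. Each operation doubles the
  sum, hence the factor 4 in the computation.\<close>

lemma len_diff_overlap:
  assumes \<rho>: "\<And>i. real_pairing (\<alpha>v i) \<rho> = 1" and x: "x \<in> W_T D" and y: "lrefl \<eta> m x \<in> W_T D"
    and e: "\<eta> \<in> \<Delta>" "apos \<eta> m" "xpos x \<eta> m"
  obtains S where "finite S" "S \<subseteq> \<Delta>" "\<eta> \<in> S"
    "len D \<rho> (lrefl \<eta> m x) - len D \<rho> x =
       (\<Sum>\<gamma>\<in>{\<gamma>\<in>S. pairing (co \<eta>) \<gamma> > 0}. max 0 (overlap \<eta> m x \<gamma>))"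
proof -
  define y where "y = lrefl \<eta> m x"
  define s where "s = (\<lambda>\<gamma>. \<gamma> - pairing (co \<eta>) \<gamma> *s \<eta>)"
  let ?c = "pairing (co \<eta>)"
  obtain S where S: "finite S" "S \<subseteq> \<Delta>" "\<eta> \<in> S" "\<And>\<gamma>. \<gamma> \<in> S \<Longrightarrow> - \<gamma> \<in> S"
    "\<And>\<gamma>. \<gamma> \<in> S \<Longrightarrow> s \<gamma> \<in> S"
    "len D \<rho> y - len D \<rho> x = (\<Sum>\<gamma>\<in>S \<inter> \<Delta>p. \<bar>threshold y \<gamma>\<bar> - \<bar>threshold x \<gamma>\<bar>)"
    using len_diff_sum[OF \<rho> x y e(1)] unfolding y_def s_def by blast
  have w: "snd x \<in> W" "snd y \<in> W" using x y W_T_snd y_def by auto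
  have cs: "?c (s \<gamma>) = - ?c \<gamma>" and ss: "s (s \<gamma>) = \<gamma>" and sm: "s (- \<gamma>) = - s \<gamma>" for \<gamma>
    by (simp_all add: s_def pairing_simps root_norm[OF e(1)] vec_eq_iff algebra_simps)
  have threshold_y: "threshold y \<gamma> = threshold x (s \<gamma>) + ?c \<gamma> * m" for \<gamma>
    unfolding y_def s_def by (rule threshold_lrefl[OF w(1) e(1)])
  \<comment> \<open>The number of \<open>n\<close> for which exactly one of
    \<open>\<gamma> + n\<pi>\<close> and its image under the inverse of \<open>z\<close> is
    positive. Unlike \<open>\<bar>threshold z \<gamma>\<bar>\<close> it is invariant under negating
    \<open>\<gamma>\<close>, and it agrees with that value on positive roots.\<close>
  define h where "h = (\<lambda>z \<gamma>. \<bar>threshold z \<gamma> - base_threshold \<gamma>\<bar>)"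
  have hm: "h z (- \<gamma>) = h z \<gamma>" if "snd z \<in> W" "\<gamma> \<in> \<Delta>" for z \<gamma>
    using that by (simp add: h_def threshold_minus base_threshold_minus)
  define T where "T = (\<lambda>\<gamma>. h y \<gamma> + h y (s \<gamma>) - h x \<gamma> - h x (s \<gamma>))"
  have Tm: "T (- \<gamma>) = T \<gamma>" if "\<gamma> \<in> S" for \<gamma>
  proof -
    have "\<gamma> \<in> \<Delta>" "s \<gamma> \<in> \<Delta>" using that S(2,5) by auto
    then show ?thesis using w by (simp add: T_def sm hm)
  qed
  have sS: "(\<Sum>\<gamma>\<in>S. g (s \<gamma>)) = (\<Sum>\<gamma>\<in>S. g \<gamma>)" for g :: "int ^ 'r \<Rightarrow> int"
    by (rule sum.reindex_bij_witness[of _ s s]) (use S(5) in \<open>auto simp: ss\<close>)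
  have "4 * (len D \<rho> y - len D \<rho> x) = 2 * (2 * (\<Sum>\<gamma>\<in>S \<inter> \<Delta>p. h y \<gamma> - h x \<gamma>))"
    unfolding S(6) by (auto simp: h_def base_threshold_def intro!: sum.cong)
  also have "2 * (\<Sum>\<gamma>\<in>S \<inter> \<Delta>p. h y \<gamma> - h x \<gamma>) = (\<Sum>\<gamma>\<in>S. h y \<gamma> - h x \<gamma>)"
    using S w by (intro sum_even_roots[symmetric]) (auto simp: hm)
  also have "2 * \<dots> = (\<Sum>\<gamma>\<in>S. h y \<gamma> - h x \<gamma>) + (\<Sum>\<gamma>\<in>S. h y (s \<gamma>) - h x (s \<gamma>))"
    using sS[of "\<lambda>\<gamma>. h y \<gamma> - h x \<gamma>"] by simp
  also have "\<dots> = (\<Sum>\<gamma>\<in>S. T \<gamma>)" by (simp add: T_def sum.distrib sum_subtractf)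
  also have "\<dots> = (\<Sum>\<gamma>\<in>S. if ?c \<gamma> > 0 then T \<gamma> else 0) + (\<Sum>\<gamma>\<in>S. if ?c \<gamma> < 0 then T \<gamma> else 0)"
  proof -
    have "T \<gamma> = 0" if "?c \<gamma> = 0" for \<gamma> using that threshold_y[of \<gamma>]
      by (simp add: T_def h_def s_def)
    then show ?thesis by (auto simp flip: sum.distrib intro!: sum.cong)
  qed
  also have "(\<Sum>\<gamma>\<in>S. if ?c \<gamma> < 0 then T \<gamma> else 0) = (\<Sum>\<gamma>\<in>S. if ?c \<gamma> > 0 then T \<gamma> else 0)"
    by (rule sum.reindex_bij_witness[of _ uminus uminus]) (use S(4) Tm in \<open>auto simp: pairing_simps\<close>)
  also have "(\<Sum>\<gamma>\<in>S. if ?c \<gamma> > 0 then T \<gamma> else 0) = (\<Sum>\<gamma>\<in>{\<gamma>\<in>S. ?c \<gamma> > 0}. T \<gamma>)"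
    using S(1) by (simp add: sum.inter_filter)
  also have "\<dots> = (\<Sum>\<gamma>\<in>{\<gamma>\<in>S. ?c \<gamma> > 0}. 2 * max 0 (overlap \<eta> m x \<gamma>))"
  proof (intro sum.cong refl)
    fix \<gamma> assume "\<gamma> \<in> {\<gamma>\<in>S. ?c \<gamma> > 0}"
    then have c: "?c \<gamma> > 0" and g: "\<gamma> \<in> \<Delta>" and base_threshold: "s \<gamma> \<in> \<Delta>" using S(2,5) by auto
    define \<gamma>' where "\<gamma>' = ?c \<gamma> *s \<eta> - \<gamma>"
    have g's: "\<gamma>' = - s \<gamma>" by (simp add: \<gamma>'_def s_def)
    have g': "\<gamma>' \<in> \<Delta>" using base_threshold root_minus by (simp add: g's)
    let ?M = "?c \<gamma> * m + 1"
    have a: "threshold x \<gamma> + threshold x \<gamma>' \<le> ?M"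
      by (rule threshold_sum_le[OF w(1) g g' e(1) _ c]) (use e w in \<open>auto simp: \<gamma>'_def xpos_iff\<close>)
    have b: "base_threshold \<gamma> + base_threshold \<gamma>' \<le> ?M"
      by (rule base_threshold_sum_le[OF g g' e(1) _ c]) (use e in \<open>auto simp: \<gamma>'_def apos_iff\<close>)
    have sgm: "s \<gamma> = - \<gamma>'" by (simp add: g's)
    have "T \<gamma> = \<bar>(?M - threshold x \<gamma>') - base_threshold \<gamma>\<bar> + \<bar>(?M - base_threshold \<gamma>') - threshold x \<gamma>\<bar> - \<bar>threshold x \<gamma> - base_threshold \<gamma>\<bar>
      - \<bar>(?M - threshold x \<gamma>') - (?M - base_threshold \<gamma>')\<bar>"
    proof -
      have 1: "threshold x (s \<gamma>) = 1 - threshold x \<gamma>'" "base_threshold (s \<gamma>) = 1 - base_threshold \<gamma>'"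
        using w g' by (simp_all add: sgm threshold_minus base_threshold_minus)
      have 2: "threshold y \<gamma> = 1 - threshold x \<gamma>' + ?c \<gamma> * m" "threshold y (s \<gamma>) = threshold x \<gamma> - ?c \<gamma> * m"
        using threshold_y[of \<gamma>] threshold_y[of "s \<gamma>"] 1 by (simp_all add: ss cs)
      show ?thesis unfolding T_def h_def 1 2 by simp
    qed
    also have "\<dots> = 2 * max 0 (min (?M - threshold x \<gamma>') (?M - base_threshold \<gamma>') - max (threshold x \<gamma>) (base_threshold \<gamma>))"
      using a b by (intro interval_overlap) auto
    also have "\<dots> = 2 * max 0 (overlap \<eta> m x \<gamma>)" by (simp add: overlap_def Let_def \<gamma>'_def)
    finally show "T \<gamma> = 2 * max 0 (overlap \<eta> m x \<gamma>)" .
  qed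
  finally have "len D \<rho> y - len D \<rho> x = (\<Sum>\<gamma>\<in>{\<gamma>\<in>S. ?c \<gamma> > 0}. max 0 (overlap \<eta> m x \<gamma>))"
    by (simp flip: sum_distrib_left)
  then show ?thesis using that S(1-3) y_def by blast
qed

lemma overlap_self: "\<eta> \<in> \<Delta> \<Longrightarrow> overlap \<eta> m x \<eta> = 2 * (m - max (threshold x \<eta>) (base_threshold \<eta>)) + 1"
proof -
  assume e: "\<eta> \<in> \<Delta>"
  have "2 *s \<eta> - \<eta> = \<eta>" by (simp add: vec_eq_iff)
  then show ?thesis by (simp add: overlap_def root_norm[OF e] Let_def max_def min_def)
qed

definition both_pos :: "'r waff \<Rightarrow> int ^ 'r \<Rightarrow> int \<Rightarrow> bool" where
  "both_pos x \<gamma> n \<longleftrightarrow> apos \<gamma> n \<and> xpos x \<gamma> n"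

lemma len_less_step:
  assumes \<rho>: "\<And>i. real_pairing (\<alpha>v i) \<rho> = 1" and "bruhat_step D x y"
  shows "len D \<rho> x < len D \<rho> y"
proof -
  obtain \<eta> m where x: "x \<in> W_T D" and y: "lrefl \<eta> m x \<in> W_T D" "y = lrefl \<eta> m x"
    and e: "\<eta> \<in> \<Delta>" "apos \<eta> m" "xpos x \<eta> m"
    using assms(2) unfolding bruhat_step_iff by blast
  obtain S where S: "finite S" "S \<subseteq> \<Delta>" "\<eta> \<in> S"
    "len D \<rho> y - len D \<rho> x = (\<Sum>\<gamma>\<in>{\<gamma>\<in>S. pairing (co \<eta>) \<gamma> > 0}. max 0 (overlap \<eta> m x \<gamma>))"
    using len_diff_overlap[OF \<rho> x y(1) e] y(2) by blast
  have "overlap \<eta> m x \<eta> > 0"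
    using overlap_self e x by (simp add: apos_iff xpos_iff W_T_snd)
  moreover have "max 0 (overlap \<eta> m x \<eta>) \<le> (\<Sum>\<gamma>\<in>{\<gamma>\<in>S. pairing (co \<eta>) \<gamma> > 0}. max 0 (overlap \<eta> m x \<gamma>))"
    using S e root_norm by (intro member_le_sum) auto
  ultimately show ?thesis using S(4) by linarith
qed

lemma len_gap_second_root:
  assumes \<rho>: "\<And>i. real_pairing (\<alpha>v i) \<rho> = 1" and x: "x \<in> W_T D" and y: "lrefl \<eta> m x \<in> W_T D"
    and e: "\<eta> \<in> \<Delta>" "apos \<eta> m" "xpos x \<eta> m"
    and gap: "len D \<rho> (lrefl \<eta> m x) \<ge> len D \<rho> x + 2"
  obtains \<gamma> n where "\<gamma> \<in> \<Delta>" "pairing (co \<eta>) \<gamma> > 0" "(\<gamma>, n) \<noteq> (\<eta>, m)" "both_pos x \<gamma> n"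
    "both_pos x (pairing (co \<eta>) \<gamma> *s \<eta> - \<gamma>) (pairing (co \<eta>) \<gamma> * m - n)"
proof -
  let ?c = "pairing (co \<eta>)"
  have w: "snd x \<in> W" using x W_T_snd by auto
  obtain S where S: "finite S" "S \<subseteq> \<Delta>" "\<eta> \<in> S"
    "len D \<rho> (lrefl \<eta> m x) - len D \<rho> x = (\<Sum>\<gamma>\<in>{\<gamma>\<in>S. ?c \<gamma> > 0}. max 0 (overlap \<eta> m x \<gamma>))"
    using len_diff_overlap[OF \<rho> x y e] by blast
  have pp: "both_pos x \<gamma> n \<and> both_pos x (?c \<gamma> *s \<eta> - \<gamma>) (?c \<gamma> * m - n)"
    if g: "\<gamma> \<in> \<Delta>" and n: "n \<ge> max (threshold x \<gamma>) (base_threshold \<gamma>)"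
      "n < max (threshold x \<gamma>) (base_threshold \<gamma>) + overlap \<eta> m x \<gamma>" for \<gamma> n
  proof -
    have "?c \<gamma> *s \<eta> - \<gamma> = - (\<gamma> - ?c \<gamma> *s \<eta>)" by simp
    then have g': "?c \<gamma> *s \<eta> - \<gamma> \<in> \<Delta>" using root_refl[OF e(1) g] root_minus by metis
    have "n < ?c \<gamma> * m + 1 - threshold x (?c \<gamma> *s \<eta> - \<gamma>)" "n < ?c \<gamma> * m + 1 - base_threshold (?c \<gamma> *s \<eta> - \<gamma>)"
      using n by (auto simp: overlap_def Let_def)
    then show ?thesis using n g g' w by (auto simp: both_pos_def apos_iff xpos_iff)
  qed
  show ?thesis
  proof (cases "\<exists>\<gamma>\<in>S. ?c \<gamma> > 0 \<and> \<gamma> \<noteq> \<eta> \<and> overlap \<eta> m x \<gamma> > 0")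
    case True
    then obtain \<gamma> where "\<gamma> \<in> S" "?c \<gamma> > 0" "\<gamma> \<noteq> \<eta>" "overlap \<eta> m x \<gamma> > 0" by auto
    then show ?thesis using pp[of \<gamma> "max (threshold x \<gamma>) (base_threshold \<gamma>)"] S(2) by (intro that[of \<gamma>]) auto
  next
    case False
    then have "(\<Sum>\<gamma>\<in>{\<gamma>\<in>S. ?c \<gamma> > 0}. max 0 (overlap \<eta> m x \<gamma>)) = (\<Sum>\<gamma>\<in>{\<eta>}. max 0 (overlap \<eta> m x \<gamma>))"
      using S e root_norm by (intro sum.mono_neutral_right) force+
    then have o: "overlap \<eta> m x \<eta> \<ge> 2" using gap S(4) by simp
    let ?t = "max (threshold x \<eta>) (base_threshold \<eta>)"
    \<comment> \<open>The overlap starting at \<open>?t\<close> has at least two elements, so one of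
      its first two differs from \<open>m\<close>.\<close>
    define n where "n = (if ?t = m then m + 1 else ?t)"
    have "n \<noteq> m" "n \<ge> ?t" "n < ?t + overlap \<eta> m x \<eta>" using o by (auto simp: n_def)
    then show ?thesis using pp[of \<eta> n] e root_norm by (intro that[of \<eta> n]) auto
  qed
qed

section \<open>Products of three reflections\<close>

lemma refl_trefl: "refl \<gamma> = trefl \<gamma> 0"
  by (auto simp: refl_def trefl_def)

lemma lrefl3_eq:
  assumes "\<And>\<mu>. trefl a i (trefl b j (trefl c k \<mu>)) = trefl e l \<mu>"
    and "\<And>\<mu>. trefl a 0 (trefl b 0 (trefl c 0 \<mu>)) = trefl e 0 \<mu>"
  shows "lrefl a i (lrefl b j (lrefl c k x)) = lrefl e l x"
proof -
  have "refl a \<circ> (refl b \<circ> (refl c \<circ> snd x)) = refl e \<circ> snd x"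
    by (auto simp: refl_trefl assms(2))
  then show ?thesis by (simp only: lrefl_def fst_conv snd_conv assms(1))
qed

text \<open>Conjugating the reflection in \<open>b\<close> by that in \<open>a\<close> gives the
  reflection in the image of \<open>b\<close>, which is \<open>a + b\<close>; the levels add in the
  same way.\<close>

lemma trefl_A2:
  assumes "a \<in> \<Delta>" "b \<in> \<Delta>" "pairing (co a) b = - 1"
  shows "trefl a i (trefl b j (trefl a i \<mu>)) = trefl (a + b) (i + j) \<mu>"
proof -
  have ba: "pairing (co b) a = - 1" using assms co_sym root_in by metis
  show ?thesis
    by (simp add: trefl_def co_add root_in assms pairing_simps root_norm ba vec_eq_iff algebra_simps)
qed

end

section \<open>Intermediate elements in affine type\<close>

text \<open>\<open>dl\<close> holds the coefficients of the null root. \<open>null_dl\<close>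
  expresses that the radical has rank one.\<close>

locale affine_datum = symmetric_datum D for D :: "('i::finite, 'r::finite) km_datum" +
  fixes dl :: "'i \<Rightarrow> int"
  assumes dl_pos: "dl i > 0"
    and dl_radical: "(\<Sum>j\<in>UNIV. gcm D i j * dl j) = 0"
    and null_dl: "gcm_form D c c = 0 \<Longrightarrow> \<exists>k. c = (\<lambda>i. k * dl i)"
begin

section \<open>The null root and the level\<close>

definition \<delta> :: "int ^ 'r" where "\<delta> = lat_root D dl"

lemma delta_in: "\<delta> \<in> rlat" by (simp add: \<delta>_def lat_root_in)

lemma pairing_coroot_delta: "\<beta> \<in> rlat \<Longrightarrow> pairing (co \<beta>) \<delta> = 0"
proof -
  assume "\<beta> \<in> rlat"
  then obtain c where "co \<beta> = lat_coroot D c" by (rule rlatE)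
  then have "pairing (co \<beta>) \<delta> = (\<Sum>i\<in>UNIV. c i * (\<Sum>j\<in>UNIV. gcm D i j * dl j))"
    by (simp add: \<delta>_def pairing_lat gcm_form_def sum_distrib_left mult.assoc)
  then show ?thesis by (simp add: dl_radical)
qed

lemma pairing_co_delta: "\<beta> \<in> rlat \<Longrightarrow> pairing (co \<delta>) \<beta> = 0"
  using pairing_coroot_delta co_sym delta_in by metis

lemma pairing_simple_coroot_delta: "pairing (\<alpha>v i) \<delta> = 0"
  using pairing_coroot_delta[OF simple_root_in] by (simp add: co_simple)

lemma level_W: "w \<in> W \<Longrightarrow> pairing (w \<mu>) \<delta> = pairing \<mu> \<delta>"
proof (induction rule: W_induct)
  case (step w i)
  then have "pairing ((sr i \<circ> w) \<mu>) \<delta> = pairing (w \<mu>) \<delta>"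
    by (simp add: simple_reflection_def pairing_simps pairing_simple_coroot_delta)
  then show ?case using step by metis
qed simp

lemma null_rlat:
  assumes "\<beta> \<in> rlat" "pairing (co \<beta>) \<beta> = 0" shows "\<exists>k. \<beta> = k *s \<delta>"
proof -
  obtain c where c: "\<beta> = lat_root D c" "co \<beta> = lat_coroot D c" using assms(1) by (rule rlatE)
  then obtain k where "c = (\<lambda>i. k * dl i)" using assms(2) null_dl[of c] by (auto simp: pairing_lat)
  then show ?thesis using c lat_root_smult[of D k dl] by (auto simp: \<delta>_def)
qed

text \<open>The difference \<open>\<gamma> - \<eta>\<close> has norm 2 + 2 - 4 = 0.\<close>

lemma root_pairing_two:
  assumes "\<eta> \<in> \<Delta>" "\<gamma> \<in> \<Delta>" "pairing (co \<eta>) \<gamma> = 2" shows "\<exists>k. \<gamma> = \<eta> + k *s \<delta>"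
proof -
  have "pairing (co (\<gamma> - \<eta>)) (\<gamma> - \<eta>) = 0"
    using assms co_sym[of \<eta> \<gamma>] by (simp add: co_diff root_in pairing_simps root_norm)
  then obtain k where "\<gamma> - \<eta> = k *s \<delta>" using null_rlat rlat_diff root_in assms by metis
  then show ?thesis by (intro exI[of _ k]) (simp add: algebra_simps)
qed

lemma radical_rlat:
  assumes "\<beta> \<in> rlat" "\<And>i. pairing (\<alpha>v i) \<beta> = 0" shows "\<exists>k. \<beta> = k *s \<delta>"
proof (rule null_rlat[OF assms(1)])
  obtain c where "co \<beta> = lat_coroot D c" using assms(1) by (rule rlatE)
  then show "pairing (co \<beta>) \<beta> = 0" by (simp add: lat_coroot_def pairing_sum_left pairing_simps assms(2))
qed

lemma pos_root_coeff_bound: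
  assumes "\<gamma> \<in> \<Delta>"
  obtains N where "N \<ge> 0" "\<And>k. k < - N \<Longrightarrow> \<gamma> + k *s \<delta> \<notin> \<Delta>p"
proof -
  obtain c where c: "\<gamma> = lat_root D c" using root_in[OF assms] by (rule rlatE)
  \<comment> \<open>Any single coefficient will do: as \<open>dl i \<ge> 1\<close>, it becomes
    negative once \<open>k\<close> is below minus its absolute value.\<close>
  fix i :: 'i
  have "\<gamma> + k *s \<delta> \<notin> \<Delta>p" if k: "k < - \<bar>c i\<bar>" for k
  proof
    assume "\<gamma> + k *s \<delta> \<in> \<Delta>p"
    then obtain e where e: "\<forall>i. e i \<ge> 0" "\<gamma> + k *s \<delta> = lat_root D e"
      unfolding pos_roots_def nonneg_comb_iff by auto
    have "lat_root D (\<lambda>i. c i + k * dl i) = lat_root D e"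
      using e(2) by (simp add: lat_root_add lat_root_smult c \<delta>_def)
    then have "c i + k * dl i = e i" using inj_lat_root by metis
    moreover have "k * dl i \<le> k * 1" using dl_pos[of i] k by (intro mult_left_mono_neg) auto
    ultimately show False using e(1)[rule_format, of i] k by linarith
  qed
  then show ?thesis using that[of "\<bar>c i\<bar>"] by auto
qed

text \<open>Otherwise infinitely many of these roots have the same pairings with simple coroots and
  hence lie in one \<open>\<delta>\<close>-translate class. Positivity of the roots bounds the
  multiple of \<open>\<delta>\<close> from below; negative pairing and positive level bound it from
  above.\<close>

lemma finite_negative_level:
  assumes L: "pairing \<mu> \<delta> > 0" shows "finite {\<gamma>\<in>\<Delta>p. pairing \<mu> \<gamma> < 0}" (is "finite ?N")
proof (rule ccontr)
  assume inf: "infinite ?N"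
  let ?f = "\<lambda>\<gamma> i. pairing (\<alpha>v i) \<gamma>"
  have "finite (?f ` ?N)"
    by (rule finite_subset[OF _ root_values_finite]) (auto simp: pos_roots_def)
  from pigeonhole_infinite[OF inf this]
  obtain \<gamma>0 where g0: "\<gamma>0 \<in> ?N" "infinite {\<gamma>\<in>?N. ?f \<gamma> = ?f \<gamma>0}" by auto
  obtain N where N: "N \<ge> 0" "\<And>k. k < - N \<Longrightarrow> \<gamma>0 + k *s \<delta> \<notin> \<Delta>p"
    using pos_root_coeff_bound[of \<gamma>0] g0(1) pos_root_root by blast
  have "{\<gamma>\<in>?N. ?f \<gamma> = ?f \<gamma>0} \<subseteq> (\<lambda>k. \<gamma>0 + k *s \<delta>) ` {- N .. \<bar>pairing \<mu> \<gamma>0\<bar>}"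
  proof
    fix \<gamma> assume g: "\<gamma> \<in> {\<gamma>\<in>?N. ?f \<gamma> = ?f \<gamma>0}"
    then have "\<gamma> - \<gamma>0 \<in> rlat" using g0(1) by (intro rlat_diff root_in pos_root_root) auto
    moreover have "pairing (\<alpha>v i) (\<gamma> - \<gamma>0) = 0" for i
      using g by (auto simp: pairing_simps dest: fun_cong)
    ultimately obtain k where "\<gamma> - \<gamma>0 = k *s \<delta>" using radical_rlat by blast
    then have k: "\<gamma> = \<gamma>0 + k *s \<delta>" by (simp add: algebra_simps)
    then have "k \<ge> - N" using N(2)[of k] g by force
    moreover have "k \<le> \<bar>pairing \<mu> \<gamma>0\<bar>"
    proof (rule ccontr)
      assume k': "\<not> ?thesis"
      have "k * 1 \<le> k * pairing \<mu> \<delta>" using L k' by (intro mult_left_mono) auto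
      moreover have "pairing \<mu> \<gamma>0 + k * pairing \<mu> \<delta> < 0"
        using g unfolding k by (simp add: pairing_simps)
      ultimately show False using k' by linarith
    qed
    ultimately show "\<gamma> \<in> (\<lambda>k. \<gamma>0 + k *s \<delta>) ` {- N .. \<bar>pairing \<mu> \<gamma>0\<bar>}" using k by auto
  qed
  then show False using g0(2) finite_subset by blast
qed

text \<open>A simple reflection with \<open>pairing \<mu> (\<alpha> i) < 0\<close> removes
  \<open>\<alpha> i\<close> from the finite set of negatively paired positive roots and permutes the
  rest, so a dominant coweight is reached.\<close>

lemma positive_level_tits: "pairing \<mu> \<delta> > 0 \<Longrightarrow> \<mu> \<in> tits_cone D"
proof (induction "card {\<gamma>\<in>\<Delta>p. pairing \<mu> \<gamma> < 0}" arbitrary: \<mu> rule: less_induct)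
  case less
  let ?N = "\<lambda>\<mu>. {\<gamma>\<in>\<Delta>p. pairing \<mu> \<gamma> < 0}"
  show ?case
  proof (cases "dominant D \<mu>")
    case True
    then have "dominant D (id \<mu>)" by simp
    then show ?thesis unfolding tits_cone_def using W_id by blast
  next
    case False
    then obtain i where i: "pairing \<mu> (\<alpha> i) < 0" by (auto simp: dominant_def not_le)
    have s: "pairing (sr i \<mu>) \<gamma> = pairing \<mu> (dual_act (sr i) \<gamma>)" for \<gamma>
      by (simp add: pairing_W W_sr inv_sr)
    have ss: "dual_act (sr i) (dual_act (sr i) \<gamma>) = \<gamma>" for \<gamma>
      using dual_act_inv(1)[OF W_sr, of i \<gamma>] by (simp add: inv_sr)
    have "?N (sr i \<mu>) \<subseteq> dual_act (sr i) ` (?N \<mu> - {\<alpha> i})"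
    proof
      fix \<gamma> assume g: "\<gamma> \<in> ?N (sr i \<mu>)"
      have "pairing (sr i \<mu>) (\<alpha> i) > 0" using i by (simp add: s sr_simple pairing_simps)
      then have "\<gamma> \<noteq> \<alpha> i" using g by auto
      then have "dual_act (sr i) \<gamma> \<in> \<Delta>p" using g sr_pos by auto
      moreover have "dual_act (sr i) \<gamma> \<noteq> \<alpha> i"
        using ss[of \<gamma>] sr_simple[of i] g pos_notin_neg[OF simple_root_pos, of i] by auto
      ultimately have "dual_act (sr i) \<gamma> \<in> ?N \<mu> - {\<alpha> i}" using g by (simp add: s)
      then show "\<gamma> \<in> dual_act (sr i) ` (?N \<mu> - {\<alpha> i})" by (rule image_eqI[rotated]) (simp only: ss)
    qed
    then have "card (?N (sr i \<mu>)) \<le> card (?N \<mu> - {\<alpha> i})"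
      using finite_negative_level[OF less.prems]
      by (meson card_image_le card_mono finite_Diff finite_imageI le_trans)
    also have "\<dots> < card (?N \<mu>)"
      using finite_negative_level[OF less.prems] i simple_root_pos
      by (intro psubset_card_mono) auto
    finally have "sr i \<mu> \<in> tits_cone D"
      using less by (simp add: level_W W_sr)
    then obtain v where v: "v \<in> W" "dominant D (v (sr i \<mu>))" by (auto simp: tits_cone_def)
    then have "v \<circ> sr i \<in> W" "dominant D ((v \<circ> sr i) \<mu>)" using W_comp W_sr by (blast, simp)
    then show ?thesis unfolding tits_cone_def by blast
  qed
qed

text \<open>The level is a strictly positive combination of the simple-root values at the dominant
  representative, so it is nonnegative and vanishes only if they all do.\<close>

lemma tits_level:
  assumes "\<mu> \<in> tits_cone D" 
  shows "pairing \<mu> \<delta> \<ge> 0" and "pairing \<mu> \<delta> = 0 \<Longrightarrow> \<beta> \<in> rlat \<Longrightarrow> pairing \<mu> \<beta> = 0"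
proof -
  obtain v where v: "v \<in> W" "dominant D (v \<mu>)" using assms by (auto simp: tits_cone_def)
  have eq: "pairing \<mu> \<delta> = (\<Sum>i\<in>UNIV. dl i * pairing (v \<mu>) (\<alpha> i))"
    using level_W[OF v(1), of \<mu>] by (simp add: \<delta>_def lat_root_def pairing_sum_right pairing_simps)
  have nn: "dl i * pairing (v \<mu>) (\<alpha> i) \<ge> 0" for i
    using v(2) dl_pos[of i] by (simp add: dominant_def)
  show "pairing \<mu> \<delta> \<ge> 0" unfolding eq using nn by (intro sum_nonneg) auto
  assume z: "pairing \<mu> \<delta> = 0" and b: "\<beta> \<in> rlat"
  have "\<forall>i\<in>UNIV. dl i * pairing (v \<mu>) (\<alpha> i) = 0"
    using z unfolding eq by (subst (asm) sum_nonneg_eq_0_iff) (use nn in auto)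
  then have 0: "pairing (v \<mu>) (\<alpha> i) = 0" for i
    using dl_pos[of i] by (metis UNIV_I mult_eq_0_iff less_irrefl)
  obtain c where "dual_act v \<beta> = lat_root D c" using dual_act_rlat[OF v(1) b] by (rule rlatE)
  then have "pairing (v \<mu>) (dual_act v \<beta>) = 0"
    by (simp add: lat_root_def pairing_sum_right pairing_simps 0)
  then show "pairing \<mu> \<beta> = 0" using v(1) by (simp add: pairing_W_dual_act)
qed

text \<open>At level 0 the Tits cone contains only coweights that are orthogonal to all roots, so only
  reflections without \<open>\<pi>\<close>-component stay inside it; at positive level there is no restriction.\<close>

definition admissible :: "'r waff \<Rightarrow> int \<Rightarrow> bool" where
  "admissible x n \<longleftrightarrow> pairing (fst x) \<delta> > 0 \<or> n = 0"

lemma level_lrefl: "\<gamma> \<in> \<Delta> \<Longrightarrow> pairing (fst (lrefl \<gamma> n x)) \<delta> = pairing (fst x) \<delta>"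
  by (simp add: lrefl_def trefl_def pairing_simps pairing_coroot_delta root_in)

lemma admissible_lrefl: "\<gamma> \<in> \<Delta> \<Longrightarrow> admissible (lrefl \<gamma> n x) l \<longleftrightarrow> admissible x l"
  by (simp add: admissible_def level_lrefl)

lemma lrefl_W_T:
  assumes "x \<in> W_T D" "\<gamma> \<in> \<Delta>" "admissible x n" shows "lrefl \<gamma> n x \<in> W_T D"
proof -
  have "fst (lrefl \<gamma> n x) \<in> tits_cone D"
  proof (cases "pairing (fst x) \<delta> > 0")
    case True
    then show ?thesis using positive_level_tits level_lrefl assms(2) by metis
  next
    case False
    then have "pairing (fst x) \<delta> = 0" "n = 0"
      using assms(3) tits_level(1)[OF W_T_fst[OF assms(1)]] by (auto simp: admissible_def)
    then have "pairing (fst x) \<gamma> = 0" using tits_level(2)[OF W_T_fst[OF assms(1)]] root_in assms(2) by blast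
    then show ?thesis using W_T_fst[OF assms(1)] \<open>n = 0\<close> by (simp add: lrefl_def trefl_def)
  qed
  moreover have "snd (lrefl \<gamma> n x) \<in> W" using lrefl_comp_W W_T_snd assms by blast
  ultimately show ?thesis by (metis W_T_def mem_Times_iff)
qed

text \<open>At level 0 the translation parts before and after both pair to 0 with
  \<open>\<gamma>\<close>, while \<open>lrefl\<close> would make the second pairing
  \<open>2 * n\<close>.\<close>

lemma W_T_admissible:
  assumes "x \<in> W_T D" "\<gamma> \<in> \<Delta>" "lrefl \<gamma> n x \<in> W_T D" shows "admissible x n"
proof (cases "pairing (fst x) \<delta> > 0")
  case False
  then have "pairing (fst x) \<delta> = 0"
    using tits_level(1)[OF W_T_fst[OF assms(1)]] by auto
  then have 0: "pairing (fst x) \<gamma> = 0" "pairing (fst (lrefl \<gamma> n x)) \<gamma> = 0"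
    using tits_level(2)[OF W_T_fst[OF assms(1)]] tits_level(2)[OF W_T_fst[OF assms(3)]]
      level_lrefl[OF assms(2)] root_in assms(2) by auto
  then show ?thesis using root_norm[OF assms(2)] by (simp add: lrefl_def trefl_def pairing_simps admissible_def)
qed (simp add: admissible_def)

text \<open>Reflections have determinant -1, so a proper factorization of one into reflections has
  at least three factors.\<close>

definition three_steps :: "'r waff \<Rightarrow> 'r waff \<Rightarrow> bool" where
  "three_steps x y \<longleftrightarrow> (\<exists>z u. bruhat_step D x z \<and> bruhat_step D z u \<and> bruhat_step D u y)"

text \<open>The path reflects in \<open>a\<close>, \<open>b\<close>, \<open>a\<close>. Transported
  back to \<open>x\<close>, the root of the second step becomes \<open>a + b\<close> and that of the
  third becomes \<open>b\<close>, and both are positive by hypothesis.\<close>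

lemma three_steps_A2:
  assumes x: "x \<in> W_T D" and a: "a \<in> \<Delta>" "both_pos x a i" "admissible x i" and b: "b \<in> \<Delta>" "both_pos x b j" "admissible x j"
    and ab: "pairing (co a) b = - 1" and e: "xpos x (a + b) (i + j)"
  shows "three_steps x (lrefl (a + b) (i + j) x)"
proof -
  have ba: "pairing (co b) a = - 1" using a b ab co_sym root_in by metis
  define z where "z = lrefl a i x"
  define u where "u = lrefl b j z"
  have w: "snd x \<in> W" using W_T_snd x by auto
  have z: "z \<in> W_T D" unfolding z_def using x a by (intro lrefl_W_T) auto
  have u: "u \<in> W_T D" unfolding u_def using z a b by (intro lrefl_W_T) (auto simp: admissible_lrefl z_def)
  have y: "lrefl a i u \<in> W_T D"
    using u a b by (intro lrefl_W_T) (auto simp: admissible_lrefl z_def u_def)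
  have eq: "lrefl a i u = lrefl (a + b) (i + j) x" unfolding u_def z_def
    using trefl_A2[OF a(1) b(1) ab] by (intro lrefl3_eq) (simp, metis add_0)
  have neg1: "a - (- 1) *s b = a + b" "b - (- 1) *s a = a + b" by (simp_all add: vec_eq_iff)
  have aa: "pairing (co a) (a + b) = 1" by (simp add: pairing_simps root_norm a ab)
  have "bruhat_step D x z" unfolding z_def
    using x z a z_def by (intro bruhat_stepI) (auto simp: both_pos_def)
  moreover have "xpos z b j" unfolding z_def xpos_lrefl[OF w a(1)] ab using e by (simp add: neg1 add.commute)
  then have "bruhat_step D z u" unfolding u_def
    using z u u_def b by (intro bruhat_stepI) (auto simp: both_pos_def)
  moreover have "xpos u a i"
    unfolding u_def xpos_lrefl[OF W_T_snd[OF z] b(1)] ba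
    using xpos_lrefl[OF w a(1), of i "a + b" "i + j"] b(2) aa
    by (simp add: z_def both_pos_def neg1)
  then have "bruhat_step D u (lrefl a i u)"
    using u y a by (intro bruhat_stepI) (auto simp: both_pos_def)
  ultimately show ?thesis unfolding three_steps_def eq by blast
qed

text \<open>Only the real-root parts of the string; its \<open>i\<close>-th member is used with
  \<open>\<pi>\<close>-coefficient \<open>m + i * j\<close>. The two step sizes stay separate
  because either may be 0.\<close>

definition delta_string :: "int ^ 'r \<Rightarrow> int \<Rightarrow> int \<Rightarrow> int ^ 'r" where
  "delta_string \<eta> k i = \<eta> + (i * k) *s \<delta>"

lemma co_delta_string: "\<eta> \<in> \<Delta> \<Longrightarrow> co (delta_string \<eta> k i) = co \<eta> + (i * k) *s co \<delta>"
  by (simp add: delta_string_def co_add co_smult root_in delta_in rlat_smult)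

lemma pairing_co_delta_string: "\<eta> \<in> \<Delta> \<Longrightarrow> pairing (co (delta_string \<eta> k i)) (delta_string \<eta> k j) = 2"
  unfolding co_delta_string by (simp add: delta_string_def pairing_simps root_norm pairing_coroot_delta pairing_co_delta root_in delta_in)

lemma delta_string_refl: "delta_string \<eta> k i - 2 *s delta_string \<eta> k j = - delta_string \<eta> k (2 * j - i)"
  by (simp add: delta_string_def vec_eq_iff algebra_simps)

text \<open>Members pair to 2, so the reflection in member \<open>j\<close> sends member
  \<open>i\<close> to minus member \<open>2 * j - i\<close>. Starting from indices 0 and 1, this
  reaches every integer.\<close>

lemma delta_string_root:
  assumes "\<eta> \<in> \<Delta>" "delta_string \<eta> k 1 \<in> \<Delta>" shows "delta_string \<eta> k i \<in> \<Delta>"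
proof -
  have s0: "delta_string \<eta> k 0 = \<eta>" by (simp add: delta_string_def)
  have refl: "delta_string \<eta> k (2 * j - i) \<in> \<Delta>" if "delta_string \<eta> k j \<in> \<Delta>" "delta_string \<eta> k i \<in> \<Delta>" for i j
    using root_refl[OF that] pairing_co_delta_string[OF assms(1)] delta_string_refl root_minus_iff by metis
  have "delta_string \<eta> k (int n) \<in> \<Delta> \<and> delta_string \<eta> k (int n + 1) \<in> \<Delta>" for n
  proof (induction n)
    case 0
    then show ?case using assms s0 by simp
  next
    case (Suc n)
    have "2 * (int n + 1) - int n = int (Suc n) + 1" by simp
    then show ?case using Suc refl[of "int n + 1" "int n"] by (simp add: add.commute)
  qed
  then have nn: "delta_string \<eta> k (int n) \<in> \<Delta>" for n by auto
  show ?thesis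
  proof (cases "i \<ge> 0")
    case True
    then show ?thesis using nn[of "nat i"] by simp
  next
    case False
    then show ?thesis using nn[of "nat (- i)"] refl[of 0 "- i"] assms(1) s0 by simp
  qed
qed

text \<open>The dihedral relation: like point reflections of a line with centres \<open>a\<close>,
  \<open>b\<close>, \<open>b - a\<close>, the three compose to one with centre
  \<open>(b - a) - b + a = 0\<close>.\<close>

lemma trefl_delta_string:
  assumes "\<eta> \<in> \<Delta>"
  shows "trefl (delta_string \<eta> k (b - a)) (m + (b - a) * j) (trefl (delta_string \<eta> k b) (m + b * j)
    (trefl (delta_string \<eta> k a) (m + a * j) \<mu>)) = trefl \<eta> m \<mu>"
proof -
  \<comment> \<open>\<open>P \<mu> + i * Q \<mu>\<close> is the quantity that the
    \<open>i\<close>-th affine reflection negates; all of these reflections preserve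
    \<open>Q\<close>.\<close>
  define P where "P = (\<lambda>\<mu>. pairing \<mu> \<eta> - m)"
  define Q where "Q = (\<lambda>\<mu>. k * pairing \<mu> \<delta> - j)"
  define T where "T = (\<lambda>i. trefl (delta_string \<eta> k i) (m + i * j))"
  have T: "T i \<mu> = \<mu> - (P \<mu> + i * Q \<mu>) *s (co \<eta> + (i * k) *s co \<delta>)" for i \<mu>
    by (simp add: T_def trefl_def co_delta_string[OF assms] P_def Q_def)
      (simp add: delta_string_def pairing_simps algebra_simps)
  have PT: "P (T i \<mu>) = - P \<mu> - 2 * i * Q \<mu>" and QT: "Q (T i \<mu>) = Q \<mu>" for i \<mu>
    unfolding T by (simp_all add: P_def Q_def pairing_simps root_norm assms pairing_coroot_delta
        pairing_co_delta root_in delta_in algebra_simps)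
  have "T (b - a) (T b (T a \<mu>)) = \<mu> - P \<mu> *s co \<eta>"
    unfolding T[of "b - a"] PT QT unfolding T[of b] PT QT unfolding T[of a]
    by (simp add: vec_eq_iff algebra_simps)
  then show ?thesis by (simp add: T_def trefl_def P_def)
qed

text \<open>The reflections in the roots of the string form an infinite dihedral group. At the first
  \<open>K + 1\<close> where the string leaves the roots that are positive on both sides, the path
  \<open>s\<^sub>K\<close>, \<open>s\<^sub>b\<close>, \<open>s\<^sub>b\<^sub>-\<^sub>K\<close> with \<open>b = K \<plusminus> 1\<close> increases in each step.\<close>

lemma three_steps_string:
  assumes x: "x \<in> W_T D" and e: "\<eta> \<in> \<Delta>" "delta_string \<eta> k 1 \<in> \<Delta>"
    and ad: "\<And>i. admissible x (m + i * j)"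
    and K: "K \<ge> 1" "\<And>i. \<bar>i\<bar> \<le> K \<Longrightarrow> both_pos x (delta_string \<eta> k i) (m + i * j)"
      "\<not> both_pos x (delta_string \<eta> k (K + 1)) (m + (K + 1) * j)"
  shows "three_steps x (lrefl \<eta> m x)"
proof -
  define A where "A = (\<lambda>i. apos (delta_string \<eta> k i) (m + i * j))"
  define X where "X = (\<lambda>z i. xpos z (delta_string \<eta> k i) (m + i * j))"
  define R where "R = (\<lambda>i. lrefl (delta_string \<eta> k i) (m + i * j))"
  note root = delta_string_root[OF e]
  have good: "A i" "X x i" if "\<bar>i\<bar> \<le> K" for i using K(2)[OF that] by (auto simp: both_pos_def A_def X_def)
  have RW: "R i z \<in> W_T D \<and> (\<forall>l. admissible (R i z) l \<longleftrightarrow> admissible z l)"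
    if "z \<in> W_T D" "\<And>l. admissible z l \<longleftrightarrow> admissible x l" for i z
    using that root ad by (simp add: R_def lrefl_W_T admissible_lrefl)
  have XR: "X (R i z) l \<longleftrightarrow> \<not> X z (2 * i - l)" if "z \<in> W_T D" for i l z
  proof -
    have w: "snd z \<in> W" using that W_T_snd by auto
    have 1: "m + l * j - 2 * (m + i * j) = - (m + (2 * i - l) * j)" by (simp add: algebra_simps)
    show ?thesis
      unfolding X_def R_def xpos_lrefl[OF w root] pairing_co_delta_string[OF e(1)] delta_string_refl 1
      using xpos_minus[OF w root] .
  qed
  have step: "bruhat_step D z (R i z)" if "z \<in> W_T D" "R i z \<in> W_T D" "A i \<longleftrightarrow> X z i" for i z
    using that root by (auto simp: R_def A_def X_def intro: bruhat_stepI)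
  have path: "three_steps x (lrefl \<eta> m x)" if "A a \<longleftrightarrow> X x a" "A b \<longleftrightarrow> \<not> X x (2 * a - b)"
    "A (b - a) \<longleftrightarrow> X x (a - b)" for a b
  proof -
    define z where "z = R a x"
    define u where "u = R b z"
    have z: "z \<in> W_T D" "\<And>l. admissible z l \<longleftrightarrow> admissible x l" using RW[OF x] by (auto simp: z_def)
    have u: "u \<in> W_T D" "\<And>l. admissible u l \<longleftrightarrow> admissible x l" using RW[OF z] by (auto simp: u_def z(2))
    have y: "R (b - a) u \<in> W_T D" using RW[OF u] by auto
    have "bruhat_step D x z" unfolding z_def using that z x by (intro step) (auto simp: z_def)
    moreover have "bruhat_step D z u" unfolding u_def
      using that z u by (intro step) (auto simp: u_def XR[OF x] z_def)
    moreover have "X u (b - a) \<longleftrightarrow> X x (a - b)"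
      unfolding u_def XR[OF z(1)] unfolding z_def XR[OF x] by (simp add: algebra_simps)
    then have "bruhat_step D u (R (b - a) u)" using that u y by (intro step) auto
    moreover have "R (b - a) u = lrefl \<eta> m x"
      unfolding u_def z_def R_def
      using trefl_delta_string[OF e(1)] trefl_delta_string[OF e(1), where m = 0 and j = 0]
      by (intro lrefl3_eq) auto
    ultimately show ?thesis unfolding three_steps_def by metis
  qed
  have "\<not> A (K + 1) \<or> \<not> X x (K + 1)" using K(3) by (auto simp: A_def X_def both_pos_def)
  then show ?thesis
  proof
    assume "\<not> A (K + 1)"
    \<comment> \<open>The middle root, of index \<open>K + 1\<close>, is negative on both sides,
      since its image is governed by index \<open>K - 1\<close>; \<open>bruhat_stepI\<close> permits
      this. \<open>K \<ge> 1\<close> puts the indices 1 and -1 of the last step in range.\<close>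
    then show ?thesis using K(1) good by (intro path[of K "K + 1"]) auto
  next
    assume "\<not> X x (K + 1)"
    then show ?thesis using K(1) good by (intro path[of K "K - 1"]) auto
  qed
qed

text \<open>Some component moves. If \<open>j \<noteq> 0\<close>, the
  \<open>\<pi>\<close>-coefficient becomes negative. If \<open>j = 0\<close> at positive level,
  moving along \<open>\<delta>\<close> raises the threshold of \<open>x\<close> above
  \<open>m\<close>. At level 0 admissibility forces \<open>m = 0\<close>, and moving along
  \<open>\<delta>\<close> turns the real root negative.\<close>

lemma string_leaves:
  assumes x: "x \<in> W_T D" and e: "\<eta> \<in> \<Delta>" "delta_string \<eta> k 1 \<in> \<Delta>"
    and ad: "\<And>i. admissible x (m + i * j)" and m: "m \<ge> 0" and kj: "k \<noteq> 0 \<or> j \<noteq> 0"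
  obtains i where "\<not> both_pos x (delta_string \<eta> k i) (m + i * j)"
proof -
  note root = delta_string_root[OF e]
  consider "j \<noteq> 0" | "j = 0" "pairing (fst x) \<delta> > 0" | "j = 0" "m = 0"
    using ad[of 0] by (auto simp: admissible_def)
  then show ?thesis
  proof cases
    case 1
    define i where "i = - (m + 1) * sgn j"
    have "sgn j * j = \<bar>j\<bar>" by (simp add: abs_sgn mult.commute)
    then have "m + i * j = m - (m + 1) * \<bar>j\<bar>" 
      by (simp only: i_def mult.assoc mult_minus_left add_uminus_conv_diff)
    also have "\<dots> \<le> m - (m + 1) * 1" using 1 m by (intro diff_left_mono mult_left_mono) auto
    finally have "m + i * j < 0" by simp
    then show ?thesis using root that[of i] by (auto simp: both_pos_def apos_iff base_threshold_def)
  next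
    case 2
    then have k: "k \<noteq> 0" using kj by auto
    define L where "L = pairing (fst x) \<delta>"
    define p where "p = pairing (fst x) \<eta>"
    \<comment> \<open>Chosen so that \<open>i * k\<close> times the level is at least
      \<open>m + \<bar>p\<bar> + 1\<close>, which outweighs the offset \<open>p\<close>.\<close>
    define i where "i = sgn k * (m + \<bar>p\<bar> + 1)"
    have "i * k * L = (m + \<bar>p\<bar> + 1) * (\<bar>k\<bar> * L)" by (simp add: i_def abs_sgn)
    moreover have "1 * 1 \<le> \<bar>k\<bar> * L" using k 2 by (intro mult_mono) (auto simp: L_def)
    then have "(m + \<bar>p\<bar> + 1) * 1 \<le> (m + \<bar>p\<bar> + 1) * (\<bar>k\<bar> * L)" using m by (intro mult_left_mono) auto
    ultimately have "m + \<bar>p\<bar> + 1 \<le> i * k * L" by (metis mult_1_right)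
    then have "p + i * k * L > m" by linarith
    then have "threshold x (delta_string \<eta> k i) > m" by (auto simp: threshold_def delta_string_def pairing_simps L_def p_def base_threshold_def)
    then show ?thesis using that[of i] 2 root W_T_snd[OF x] by (auto simp: both_pos_def xpos_iff)
  next
    case 3
    then have k: "k \<noteq> 0" using kj by auto
    obtain N where N: "N \<ge> 0" "\<And>k. k < - N \<Longrightarrow> \<eta> + k *s \<delta> \<notin> \<Delta>p"
      using pos_root_coeff_bound[OF e(1)] by blast
    define i where "i = - sgn k * (N + 1)"
    have "(N + 1) * 1 \<le> (N + 1) * \<bar>k\<bar>" using k N(1) by (intro mult_left_mono) auto
    then have "i * k < - N" by (simp add: i_def abs_sgn mult_ac)
    then have "delta_string \<eta> k i \<notin> \<Delta>p" using N(2) by (simp add: delta_string_def)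
    then show ?thesis using that[of i] 3 root by (auto simp: both_pos_def apos_iff base_threshold_def)
  qed
qed

lemma three_steps_null:
  assumes x: "x \<in> W_T D" and e: "\<eta> \<in> \<Delta>" "delta_string \<eta> k 1 \<in> \<Delta>"
    and ad: "\<And>i. admissible x (m + i * j)" and kj: "k \<noteq> 0 \<or> j \<noteq> 0"
    and pp: "both_pos x \<eta> m" "both_pos x (delta_string \<eta> k 1) (m + j)" "both_pos x (delta_string \<eta> k (- 1)) (m - j)"
  shows "three_steps x (lrefl \<eta> m x)"
proof -
  define G where "G = (\<lambda>i. both_pos x (delta_string \<eta> k i) (m + i * j))"
  have m: "m \<ge> 0" using pp(1) e by (auto simp: both_pos_def apos_iff base_threshold_def split: if_splits)
  obtain i where "\<not> G i" unfolding G_def using string_leaves[OF x e ad m kj] by blast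
  then have ex: "\<exists>n. \<not> (G (int n) \<and> G (- int n))"
    by (metis abs_of_nonneg abs_of_nonpos add.inverse_inverse nat_0_le abs_ge_zero linorder_linear)
  \<comment> \<open>The first failure of the window symmetric about 0, since
    \<open>three_steps_string\<close> needs both signs of each smaller index.\<close>
  define n where "n = (LEAST n. \<not> (G (int n) \<and> G (- int n)))"
  have n: "\<not> (G (int n) \<and> G (- int n))" unfolding n_def by (rule LeastI_ex[OF ex])
  have G01: "G 0" "G 1" "G (- 1)" using pp by (auto simp: G_def delta_string_def)
  have "n \<noteq> 0" "n \<noteq> 1" using n G01 by (cases "n = 0", auto)+
  define K where "K = int n - 1"
  have K: "K \<ge> 1" using \<open>n \<noteq> 0\<close> \<open>n \<noteq> 1\<close> by (simp add: K_def)
  have small: "G i" if "\<bar>i\<bar> \<le> K" for i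
  proof -
    have "nat \<bar>i\<bar> < n" using that by (simp add: K_def)
    then have "G (int (nat \<bar>i\<bar>)) \<and> G (- int (nat \<bar>i\<bar>))" unfolding n_def using not_less_Least by blast
    then show ?thesis by (cases "i \<ge> 0") auto
  qed
  from n consider "\<not> G (K + 1)" | "\<not> G (- (K + 1))" by (auto simp: K_def)
  then show ?thesis
  proof cases
    case 1
    then show ?thesis using small K by (intro three_steps_string[OF x e ad]) (auto simp: G_def)
  next
    case 2
    \<comment> \<open>Failure at the negative end is reduced to the other case by reversing the
      string, with \<open>- k\<close> and \<open>- j\<close>.\<close>
    have neg: "delta_string \<eta> (- k) i = delta_string \<eta> k (- i)" for i by (simp add: delta_string_def)
    have small': "both_pos x (delta_string \<eta> k (- i)) (m + i * - j)" if "\<bar>i\<bar> \<le> K" for i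
      using small[of "- i"] that by (simp add: G_def)
    have ad': "admissible x (m + i * - j)" for i using ad[of "- i"] by simp
    have last: "m + (- K - 1) * j = m - (K + 1) * j" by (simp add: algebra_simps)
    show ?thesis
      by (rule three_steps_string[where k = "- k", OF x e(1) _ ad' K])
        (use small' 2 delta_string_root[OF e] in \<open>auto simp: neg G_def last\<close>)
  qed
qed

lemma three_steps_gap:
  assumes \<rho>: "\<And>i. real_pairing (\<alpha>v i) \<rho> = 1" and "bruhat_step D x y"
    and gap: "len D \<rho> y \<ge> len D \<rho> x + 2"
  shows "three_steps x y"
proof -
  obtain \<eta> m where x: "x \<in> W_T D" and y: "lrefl \<eta> m x \<in> W_T D" "y = lrefl \<eta> m x"
    and e: "\<eta> \<in> \<Delta>" "apos \<eta> m" "xpos x \<eta> m"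
    using assms(2) unfolding bruhat_step_iff by blast
  obtain \<gamma> n where g: "\<gamma> \<in> \<Delta>" "pairing (co \<eta>) \<gamma> > 0" "(\<gamma>, n) \<noteq> (\<eta>, m)" "both_pos x \<gamma> n"
    "both_pos x (pairing (co \<eta>) \<gamma> *s \<eta> - \<gamma>) (pairing (co \<eta>) \<gamma> * m - n)"
    using len_gap_second_root[OF \<rho> x y(1) e gap[unfolded y(2)]] .
  define c where "c = pairing (co \<eta>) \<gamma>"
  have g': "c *s \<eta> - \<gamma> \<in> \<Delta>"
    using root_minus[OF root_refl[OF e(1) g(1)]] by (simp add: c_def)
  have admissible: "admissible x m" by (rule W_T_admissible[OF x e(1) y(1)])
  have nn: "n \<ge> 0" "c * m - n \<ge> 0"
    using g(1,4,5) g' by (auto simp: both_pos_def apos_iff base_threshold_def c_def split: if_splits)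
  \<comment> \<open>At level 0 admissibility gives \<open>m = 0\<close>, and the two inequalities
    \<open>nn\<close> then force \<open>n = 0\<close>.\<close>
  have adm0: "admissible x n" "admissible x (c * m - n)" using admissible nn by (auto simp: admissible_def)
  have ge: "pairing (co \<gamma>) \<eta> = c" using co_sym e g root_in c_def by metis
  have "\<bar>c\<bar> \<le> 2" unfolding c_def using e g by (intro abs_root_pairing_le root_in root_norm)
  then have "c = 1 \<or> c = 2" using g(2) unfolding c_def by linarith
  then consider "c = 1" | "c = 2" by blast
  then show ?thesis
  proof cases
    case 1
    then have ad: "\<gamma> + (\<eta> - \<gamma>) = \<eta>" "n + (m - n) = m" "\<eta> - \<gamma> \<in> \<Delta>" using g' by auto
    have "three_steps x (lrefl (\<gamma> + (\<eta> - \<gamma>)) (n + (m - n)) x)"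
    proof (rule three_steps_A2[OF x g(1,4) adm0(1) ad(3)])
      show "pairing (co \<gamma>) (\<eta> - \<gamma>) = - 1" using g 1 ge by (simp add: pairing_simps root_norm)
    qed (use g(5) adm0 e 1 in \<open>auto simp: c_def[symmetric]\<close>)
    then show ?thesis using ad y(2) by simp
  next
    case 2
    obtain k where k: "\<gamma> = \<eta> + k *s \<delta>" using root_pairing_two[OF e(1) g(1)] 2 c_def by auto
    have s: "delta_string \<eta> k 1 = \<gamma>" "delta_string \<eta> k (- 1) = 2 *s \<eta> - \<gamma>"
      by (simp_all add: delta_string_def k vec_eq_iff)
    have "admissible x (m + i * (n - m))" for i using admissible adm0 by (auto simp: admissible_def)
    moreover have "k \<noteq> 0 \<or> n - m \<noteq> 0" using g(3) k by auto
    ultimately have "three_steps x (lrefl \<eta> m x)"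
      using g e 2 by (intro three_steps_null[where k = k and j = "n - m"] x e(1))
        (auto simp: s both_pos_def c_def[symmetric] algebra_simps)
    then show ?thesis using y by simp
  qed
qed

section \<open>From increasing steps to covers\<close>

lemma len_less:
  assumes \<rho>: "\<And>i. real_pairing (\<alpha>v i) \<rho> = 1" and "bruhat_less D x y"
  shows "len D \<rho> x < len D \<rho> y"
proof -
  have "(bruhat_step D)\<^sup>+\<^sup>+ x y"
    using assms(2) by (auto simp: bruhat_less_def bruhat_le_def rtranclp_into_tranclp2 dest: rtranclpD)
  then show ?thesis
  proof (induction rule: tranclp_induct)
    case (base y)
    then show ?case by (rule len_less_step[OF \<rho>])
  next
    case (step y z)
    then show ?case using len_less_step[OF \<rho>, of y z] by linarith
  qed
qed

text \<open>Strict monotonicity of the length rules out \<open>x = z\<close>, so antisymmetry of the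
  order is not presupposed.\<close>

lemma step_less:
  assumes \<rho>: "\<And>i. real_pairing (\<alpha>v i) \<rho> = 1" and "bruhat_step D x y" "(bruhat_step D)\<^sup>*\<^sup>* y z" "z \<in> W_T D"
  shows "bruhat_less D x z"
proof -
  have "x \<in> W_T D" "y \<in> W_T D" using assms(2) by (auto simp: bruhat_step_def)
  then have le: "bruhat_le D y z" "bruhat_le D x z" using assms by (auto simp: bruhat_le_def)
  have "len D \<rho> x < len D \<rho> y" by (rule len_less_step[OF \<rho> assms(2)])
  moreover have "len D \<rho> y \<le> len D \<rho> z"
    using len_less[OF \<rho>, of y z] le by (cases "y = z") (auto simp: bruhat_less_def)
  ultimately show ?thesis using le by (auto simp: bruhat_less_def)
qed

theorem bruhat_covers_iff:
  assumes \<rho>: "\<And>i. real_pairing (\<alpha>v i) \<rho> = 1"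
  shows "bruhat_covers D x y \<longleftrightarrow> bruhat_less D x y \<and> len D \<rho> x = len D \<rho> y - 1"
proof
  assume R: "bruhat_less D x y \<and> len D \<rho> x = len D \<rho> y - 1"
  have False if "bruhat_less D x z" "bruhat_less D z y" for z
    using len_less[OF \<rho> that(1)] len_less[OF \<rho> that(2)] R by linarith
  then show "bruhat_covers D x y" using R by (auto simp: bruhat_covers_def)
next
  assume C: "bruhat_covers D x y"
  then have xy: "bruhat_less D x y" by (simp add: bruhat_covers_def)
  then have "x \<noteq> y" and yT: "y \<in> W_T D" and "(bruhat_step D)\<^sup>*\<^sup>* x y"
    by (auto simp: bruhat_less_def bruhat_le_def)
  \<comment> \<open>A chain with at least two steps places \<open>z\<close> strictly between
    \<open>x\<close> and \<open>y\<close>. Hence a cover is a single step, and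
    \<open>three_steps_gap\<close> cannot apply to it.\<close>
  have no: False if "bruhat_step D x z" "bruhat_step D z u" "(bruhat_step D)\<^sup>*\<^sup>* u y" for z u
  proof -
    have "z \<in> W_T D" using that by (auto simp: bruhat_step_def)
    then show False
      using step_less[OF \<rho> that(1) rtranclp.rtrancl_refl] step_less[OF \<rho> that(2,3) yT] C
      by (auto simp: bruhat_covers_def)
  qed
  obtain z where z: "bruhat_step D x z" "(bruhat_step D)\<^sup>*\<^sup>* z y"
    using \<open>(bruhat_step D)\<^sup>*\<^sup>* x y\<close> \<open>x \<noteq> y\<close> by (metis converse_rtranclpE)
  have "z = y" using z(2) no[OF z(1)] by (metis converse_rtranclpE)
  then have st: "bruhat_step D x y" using z by simp
  have "\<not> len D \<rho> y \<ge> len D \<rho> x + 2"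
    using three_steps_gap[OF \<rho> st] no unfolding three_steps_def by (meson rtranclp.rtrancl_refl rtranclp.rtrancl_into_rtrancl)
  then show "bruhat_less D x y \<and> len D \<rho> x = len D \<rho> y - 1"
    using xy len_less_step[OF \<rho> st] by linarith
qed

end

section \<open>The affinization of an ADE datum\<close>

lemma vector_smult_minus: "k *s (- v) = - (k *s v)" for v :: "int ^ 'r::finite"
  by (simp add: vec_eq_iff)

lemma UNIV_aff_coord: "(UNIV :: 'r aff_coord set) = insert Cent (insert Deg (range Fin))"
  by (auto intro: aff_coord.exhaust)

lemma aff_vec_nth [simp]: "aff_vec m v n $ Cent = m" "aff_vec m v n $ Fin k = v $ k" "aff_vec m v n $ Deg = n"
  by (simp_all add: aff_vec_def)

lemma aff_vec_eq_iff: "aff_vec m v n = aff_vec m' v' n' \<longleftrightarrow> m = m' \<and> v = v' \<and> n = n'"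
  by (metis aff_vec_nth vec_eq_iff)

lemma pairing_aff_vec: "pairing (aff_vec m v n) (aff_vec m' v' n') = m * m' + pairing v v' + n * n'"
  unfolding pairing_def UNIV_aff_coord
  by (subst sum.insert | simp add: sum.reindex inj_on_def image_iff)+

lemma aff_vec_add: "aff_vec m v n + aff_vec m' v' n' = aff_vec (m + m') (v + v') (n + n')"
  and aff_vec_smult: "k *s aff_vec m v n = aff_vec (k * m) (k *s v) (k * n)"
  and aff_vec_zero: "aff_vec 0 0 0 = 0"
  by (auto simp: aff_vec_def vec_eq_iff split: aff_coord.splits)

lemma aff_vec_sum: "(\<Sum>i\<in>A. aff_vec (m i) (v i) (n i)) = aff_vec (sum m A) (sum v A) (sum n A)"
  by (induction A rule: infinite_finite_induct) (auto simp: aff_vec_zero aff_vec_add)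

lemma sum_option: "(\<Sum>i\<in>UNIV. f i) = f None + (\<Sum>i\<in>UNIV. f (Some i))"
  for f :: "'i::finite option \<Rightarrow> 'b::comm_monoid_add"
  by (simp add: UNIV_option_conv sum.reindex)

locale definite_datum = symmetric_datum D for D :: "('i::finite, 'r::finite) km_datum" +
  assumes definite: "gcm_form D c c = 0 \<Longrightarrow> c = (\<lambda>i. 0)"
    and indecomp: "indecomposable D"
begin

text \<open>The highest root is given only by a definite description; it is reached by showing that
  there is exactly one dominant root.\<close>

definition dom_root :: "int ^ 'r \<Rightarrow> bool" where
  "dom_root \<beta> \<longleftrightarrow> \<beta> \<in> \<Delta> \<and> (\<forall>i. pairing (\<alpha>v i) \<beta> \<ge> 0)"

section \<open>Existence and uniqueness of the highest root\<close>

lemma dom_root_pairing_nonneg: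
  assumes "dom_root \<beta>" "nonneg_comb D \<eta>" shows "pairing (co \<eta>) \<beta> \<ge> 0"
proof -
  obtain c where "\<forall>i. c i \<ge> 0" "\<eta> = lat_root D c" using assms(2) unfolding nonneg_comb_iff by auto
  then show ?thesis using assms(1)
    by (auto simp: co_lat_root lat_coroot_def pairing_sum_left pairing_simps dom_root_def intro!: sum_nonneg)
qed

lemma definite_rlat: "\<beta> \<in> rlat \<Longrightarrow> pairing (co \<beta>) \<beta> = 0 \<Longrightarrow> \<beta> = 0"
proof -
  assume "\<beta> \<in> rlat" and 0: "pairing (co \<beta>) \<beta> = 0"
  then obtain c where c: "\<beta> = lat_root D c" "co \<beta> = lat_coroot D c" by (auto elim: rlatE)
  then have "c = (\<lambda>i. 0)" using 0 by (intro definite) (simp add: pairing_lat)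
  then show "\<beta> = 0" using c by (simp add: lat_root_def)
qed

lemma nondegenerate: "\<beta> \<in> rlat \<Longrightarrow> (\<And>i. pairing (\<alpha>v i) \<beta> = 0) \<Longrightarrow> \<beta> = 0"
proof -
  assume b: "\<beta> \<in> rlat" and 0: "\<And>i. pairing (\<alpha>v i) \<beta> = 0"
  obtain c where "co \<beta> = lat_coroot D c" using b by (rule rlatE)
  then have "pairing (co \<beta>) \<beta> = 0" by (simp add: lat_coroot_def pairing_sum_left pairing_simps 0)
  then show "\<beta> = 0" using definite_rlat b by blast
qed

lemma finite_roots: "finite \<Delta>"
proof (rule finite_imageD[OF root_values_finite], rule inj_onI)
  fix a b assume ab: "a \<in> \<Delta>" "b \<in> \<Delta>" "(\<lambda>i. pairing (\<alpha>v i) a) = (\<lambda>i. pairing (\<alpha>v i) b)"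
  then have "pairing (\<alpha>v i) (a - b) = 0" for i by (auto simp: pairing_simps dest: fun_cong)
  then have "a - b = 0" using nondegenerate rlat_diff root_in ab by blast
  then show "a = b" by simp
qed

text \<open>Take a root of maximal height \<open>h\<close> among those above \<open>\<beta>\<close>.
  A negative pairing with a simple coroot would let the simple reflection raise the height
  further.\<close>

lemma dom_root_above:
  assumes b: "\<beta> \<in> \<Delta>" obtains \<gamma> where "dom_root \<gamma>" "nonneg_comb D (\<gamma> - \<beta>)"
proof -
  define h where "h = (\<lambda>\<gamma>. \<Sum>i\<in>UNIV. inv (lat_root D) \<gamma> i)"
  have h: "h (lat_root D c) = sum c UNIV" for c
    unfolding h_def using inj_lat_root by (subst inv_f_f) (auto simp: inj_def)
  let ?A = "{\<gamma>\<in>\<Delta>. nonneg_comb D (\<gamma> - \<beta>)}"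
  have "nonneg_comb D 0" unfolding nonneg_comb_iff by (intro exI[of _ "\<lambda>i. 0"]) (simp add: lat_root_def)
  then have "\<beta> \<in> ?A" using b by simp
  then have "Max (h ` ?A) \<in> h ` ?A" using finite_roots by (intro Max_in) auto
  then obtain \<gamma> where g: "\<gamma> \<in> ?A" "h \<gamma> = Max (h ` ?A)" by auto
  have gmax: "h \<gamma>' \<le> h \<gamma>" if "\<gamma>' \<in> ?A" for \<gamma>'
    unfolding g(2) using that finite_roots by (intro Max_ge) auto
  have "pairing (\<alpha>v i) \<gamma> \<ge> 0" for i
  proof (rule ccontr)
    define k where "k = - pairing (\<alpha>v i) \<gamma>"
    assume "\<not> ?thesis"
    then have k: "k > 0" by (simp add: k_def)
    have "dual_act (sr i) \<gamma> = \<gamma> + k *s \<alpha> i" by (simp add: dual_act_sr k_def vec_eq_iff)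
    then have r: "\<gamma> + k *s \<alpha> i \<in> \<Delta>" using g dual_act_root[OF W_sr, of \<gamma> i] by simp
    have "nonneg_comb D ((\<gamma> - \<beta>) + k *s \<alpha> i)"
      using g k by (intro nonneg_comb_add nonneg_comb_smult nonneg_comb_simple) auto
    then have "nonneg_comb D (\<gamma> + k *s \<alpha> i - \<beta>)" by (simp add: algebra_simps)
    then have "h (\<gamma> + k *s \<alpha> i) \<le> h \<gamma>" using r by (intro gmax) auto
    moreover obtain c where c: "\<gamma> = lat_root D c" using g root_in rlatE by blast
    have "\<gamma> + k *s \<alpha> i = lat_root D (\<lambda>j. c j + k * unit_at i j)"
      by (simp only: lat_root_add lat_root_smult lat_root_unit c)
    then have "h (\<gamma> + k *s \<alpha> i) = h \<gamma> + k"
      by (simp only: h c sum.distrib) (simp add: if_distrib[of "\<lambda>a. k * a"] cong: if_cong)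
    ultimately show False using k by simp
  qed
  then show ?thesis using that g by (auto simp: dom_root_def)
qed

text \<open>An index outside the support but linked to it would make the pairing with its coroot
  negative. Hence the support is not linked to its complement, and indecomposability makes it
  everything.\<close>

lemma dom_root_coeffs:
  assumes d: "dom_root \<theta>" and m: "\<theta> = lat_root D m" shows "m i > 0"
proof -
  have t: "\<theta> \<in> \<Delta>" and dom: "pairing (\<alpha>v i) \<theta> \<ge> 0" for i using d by (auto simp: dom_root_def)
  have m2: "gcm_form D m m = 2" using root_norm[OF t] by (simp add: m co_lat_root pairing_lat)
  have pm: "pairing (\<alpha>v i) \<theta> = (\<Sum>j\<in>UNIV. gcm D i j * m j)" for i
    by (simp add: m lat_root_def pairing_sum_right pairing_simps pairing_simple mult.commute)
  have "gcm_form D m m = (\<Sum>i\<in>UNIV. m i * pairing (\<alpha>v i) \<theta>)"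
    by (simp add: gcm_form_def pm sum_distrib_left mult.assoc)
  then have sum2: "(\<Sum>i\<in>UNIV. m i * pairing (\<alpha>v i) \<theta>) = 2" using m2 by simp
  have nn: "m i \<ge> 0" for i
  proof -
    have "\<not> (\<forall>i. m i \<le> 0)"
    proof
      assume "\<forall>i. m i \<le> 0"
      then have "(\<Sum>i\<in>UNIV. m i * pairing (\<alpha>v i) \<theta>) \<le> 0"
        using d by (intro sum_nonpos mult_nonpos_nonneg) (auto simp: dom_root_def)
      then show False using sum2 by simp
    qed
    then show ?thesis using root_coeffs[OF m2] by blast
  qed
  define J where "J = {i. m i = 0}"
  have "J \<noteq> UNIV"
  proof
    assume "J = UNIV"
    then have "m i = 0" for i by (auto simp: J_def)
    then show False using sum2 by simp
  qed
  moreover have "gcm D i j = 0" if "i \<in> J" "j \<in> - J" for i j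
  proof (rule ccontr)
    assume n0: "gcm D i j \<noteq> 0"
    have "i \<noteq> j" using that by auto
    then have neg: "gcm D i j * m j < 0"
      using n0 offdiag[of i j] nn[of j] that(2) by (intro mult_neg_pos) (auto simp: J_def order_less_le)
    have le: "gcm D i l * m l \<le> 0" for l
    proof (cases "l = i")
      case True
      then show ?thesis using that by (simp add: J_def)
    next
      case False
      then show ?thesis using offdiag[of i l] nn[of l] by (simp add: mult_nonpos_nonneg)
    qed
    have "(\<Sum>l\<in>UNIV - {j}. gcm D i l * m l) \<le> 0" using le by (intro sum_nonpos) auto
    then have "pairing (\<alpha>v i) \<theta> < 0" unfolding pm using neg by (subst sum.remove[of _ j]) auto
    then show False using dom[of i] by simp
  qed
  ultimately have "J = {}" using indecomp unfolding indecomposable_def by blast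
  then show ?thesis using nn[of i] by (auto simp: J_def order_less_le)
qed

text \<open>Full support makes the pairing of two dominant roots positive, so it is 1 or 2. If 2,
  the difference has norm 0. If 1, the difference is a root, and its positive sign would pair to -1
  with one of the two dominant roots.\<close>

lemma dom_root_unique:
  assumes a: "dom_root a" and b: "dom_root b" shows "a = b"
proof -
  have ab: "a \<in> \<Delta>" "b \<in> \<Delta>" using a b by (auto simp: dom_root_def)
  define c where "c = pairing (co a) b"
  have c': "pairing (co b) a = c" using co_sym ab root_in c_def by metis
  obtain m where m: "a = lat_root D m" "co a = lat_coroot D m" using root_in[OF ab(1)] by (rule rlatE)
  have mp: "m i > 0" for i using dom_root_coeffs[OF a m(1)] .
  have cs: "c = (\<Sum>i\<in>UNIV. m i * pairing (\<alpha>v i) b)"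
    by (simp add: c_def m(2) lat_coroot_def pairing_sum_left pairing_simps)
  have nn: "m i * pairing (\<alpha>v i) b \<ge> 0" for i using mp[of i] b by (simp add: dom_root_def)
  have "c \<noteq> 0"
  proof
    assume "c = 0"
    then have "\<forall>i\<in>UNIV. m i * pairing (\<alpha>v i) b = 0"
      unfolding cs by (subst (asm) sum_nonneg_eq_0_iff) (use nn in auto)
    then have "pairing (\<alpha>v i) b = 0" for i using mp[of i] by (metis UNIV_I mult_eq_0_iff less_irrefl)
    then show False using nondegenerate root_in root_nonzero ab by blast
  qed
  moreover have "c \<ge> 0" unfolding cs using nn by (intro sum_nonneg) auto
  moreover have "c \<le> 2" using abs_root_pairing_le[of a b] ab root_in root_norm by (simp add: c_def)
  ultimately consider "c = 1" | "c = 2" by linarith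
  then show ?thesis
  proof cases
    case 1
    have "a - b \<in> \<Delta>" using root_refl[OF ab(2,1)] c' 1 by simp
    then consider "nonneg_comb D (a - b)" | "nonneg_comb D (b - a)" using root_nonneg_or by fastforce
    then show ?thesis
    proof cases
      case 1
      then show ?thesis using dom_root_pairing_nonneg[OF b 1] \<open>c = 1\<close> ab
        by (simp add: co_diff root_in pairing_simps root_norm flip: c_def)
    next
      case 2
      then show ?thesis using dom_root_pairing_nonneg[OF a 2] \<open>c = 1\<close> ab c'
        by (simp add: co_diff root_in pairing_simps root_norm)
    qed
  next
    case 2
    then have "pairing (co (a - b)) (a - b) = 0"
      using ab c' by (simp add: co_diff root_in pairing_simps root_norm flip: c_def)
    then have "a - b = 0" using definite_rlat rlat_diff root_in ab by blast
    then show ?thesis by simp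
  qed
qed

lemma dom_root_highest: "dom_root (highest_root D)"
proof -
  obtain \<theta> where t: "dom_root \<theta>" using dom_root_above simple_root_root by blast
  have "highest_root D = \<theta>" unfolding highest_root_def
  proof (rule the_equality)
    show "\<theta> \<in> \<Delta> \<and> (\<forall>\<beta>\<in>\<Delta>. nonneg_comb D (\<theta> - \<beta>))"
      using t dom_root_above dom_root_unique by (metis dom_root_def)
  next
    fix \<theta>' assume t': "\<theta>' \<in> \<Delta> \<and> (\<forall>\<beta>\<in>\<Delta>. nonneg_comb D (\<theta>' - \<beta>))"
    have "nonneg_comb D (\<theta> - \<theta>')" using t t' dom_root_above dom_root_unique by metis
    moreover have "nonneg_comb D (- (\<theta> - \<theta>'))" using t t' by (simp add: dom_root_def)
    ultimately have "\<theta> - \<theta>' = 0" by (rule nonneg_comb_antisym)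
    then show "\<theta>' = \<theta>" by simp
  qed
  then show ?thesis using t by simp
qed

text \<open>The Kac labels: the coefficients of the highest root, which become those of the null
  root once \<open>None\<close> is given label 1.\<close>

definition mark :: "'i \<Rightarrow> int" where "mark = inv (lat_root D) (highest_root D)"

lemma highest_root_mark: "highest_root D = lat_root D mark"
  and coroot_highest_mark: "coroot D (highest_root D) = lat_coroot D mark"
proof -
  have "highest_root D \<in> \<Delta>" using dom_root_highest by (simp add: dom_root_def)
  then show "highest_root D = lat_root D mark" "coroot D (highest_root D) = lat_coroot D mark"
    using root_in coroot_eq unfolding mark_def rlat_def co_def by (auto simp: f_inv_into_f)
qed

lemma mark_pos: "mark i > 0"
  using dom_root_coeffs[OF dom_root_highest highest_root_mark] .

text \<open>The quotient map modulo the null root, in coordinates: \<open>None\<close> stands for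
  the null root minus the highest root, so it contributes \<open>- mark\<close>.\<close>

definition proj :: "('i option \<Rightarrow> int) \<Rightarrow> 'i \<Rightarrow> int" where
  "proj c i = c (Some i) - c None * mark i"

lemma lat_root_aff: "lat_root (affinization D) c = aff_vec 0 (lat_root D (proj c)) (c None)"
proof -
  have "lat_root D (proj c) = (\<Sum>i\<in>UNIV. c (Some i) *s \<alpha> i) - c None *s highest_root D"
    unfolding proj_def lat_root_diff lat_root_smult highest_root_mark by (simp add: lat_root_def)
  then show ?thesis
    unfolding lat_root_def[of "affinization D"]
    by (simp add: affinization_def sum_option aff_vec_smult aff_vec_sum aff_vec_add aff_vec_eq_iff
        vector_smult_minus)
qed

lemma lat_coroot_aff: "lat_coroot (affinization D) c = aff_vec (c None) (lat_coroot D (proj c)) 0"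
proof -
  have "lat_coroot D (proj c) = (\<Sum>i\<in>UNIV. c (Some i) *s \<alpha>v i) - c None *s coroot D (highest_root D)"
    unfolding proj_def lat_coroot_diff lat_coroot_smult coroot_highest_mark by (simp add: lat_coroot_def)
  then show ?thesis
    unfolding lat_coroot_def[of "affinization D"]
    by (simp add: affinization_def sum_option aff_vec_smult aff_vec_sum aff_vec_add aff_vec_eq_iff
        vector_smult_minus)
qed

text \<open>The affine form is the definite form pulled back along \<open>proj\<close>. It is
  therefore semidefinite, with radical spanned by the kernel vector of \<open>proj\<close>, which is
  1 at \<open>None\<close> and \<open>mark\<close> elsewhere.\<close>

lemma gcm_form_aff: "gcm_form (affinization D) c e = gcm_form D (proj c) (proj e)"
  by (simp add: lat_root_aff lat_coroot_aff pairing_aff_vec flip: pairing_lat)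

lemma gcm_unit: "gcm E i j = gcm_form E (unit_at i) (unit_at j)" for E :: "('j::finite, 's::finite) km_datum"
  by (simp add: gcm_def lat_root_unit lat_coroot_unit flip: pairing_lat)

lemma proj_unit: "proj (unit_at (Some i)) = unit_at i" "proj (unit_at None) = (\<lambda>i. - mark i)"
  by (auto simp: proj_def)

lemma gcm_form_minus: "gcm_form D (\<lambda>i. - c i) e = - gcm_form D c e"
  "gcm_form D c (\<lambda>i. - e i) = - gcm_form D c e"
  by (simp_all add: gcm_form_def sum_negf)

lemma affinization_offdiag: "i \<noteq> j \<Longrightarrow> gcm (affinization D) i j \<le> 0"
proof -
  have 1: "gcm_form D (unit_at j) mark \<ge> 0" for j
    using dom_root_highest pairing_lat[of D "unit_at j" mark]
    by (metis dom_root_def highest_root_mark lat_coroot_unit)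
  assume "i \<noteq> j"
  then show ?thesis unfolding gcm_unit[of "affinization D"] gcm_form_aff
    using offdiag 1 1[unfolded gcm_form_sym[of _ mark]]
    by (cases i; cases j) (simp_all add: proj_unit gcm_form_minus flip: gcm_unit)
qed

lemma proj_zero: "proj c = (\<lambda>i. 0) \<Longrightarrow> c = (\<lambda>i. c None * case_option 1 mark i)"
proof
  fix i assume "proj c = (\<lambda>i. 0)"
  then have "proj c j = 0" for j by simp
  then show "c i = c None * case_option 1 mark i" by (cases i) (auto simp: proj_def)
qed

lemma affine_datum_affinization: "affine_datum (affinization D) (case_option 1 mark)"
proof
  let ?D = "affinization D" and ?dl = "case_option 1 mark"
  have mk2: "gcm_form D mark mark = 2"
    using dom_root_highest root_norm[of "highest_root D"] unfolding dom_root_def highest_root_mark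
    by (simp add: co_lat_root pairing_lat)
  show "gcm ?D i i = 2" for i
    unfolding gcm_unit[of ?D] gcm_form_aff using mk2 diag
    by (cases i) (simp_all add: proj_unit gcm_form_minus flip: gcm_unit)
  show "gcm ?D i j = gcm ?D j i" for i j
    unfolding gcm_unit[of ?D] gcm_form_aff by (rule gcm_form_sym)
  show "i \<noteq> j \<Longrightarrow> gcm ?D i j \<le> 0" for i j by (rule affinization_offdiag)
  show nul: "\<exists>k. c = (\<lambda>i. k * ?dl i)" if "gcm_form ?D c c = 0" for c
    using definite that proj_zero unfolding gcm_form_aff by blast
  show dlp: "?dl i > 0" for i using mark_pos by (cases i) auto
  show "lin_indep (simple_root ?D)"
    unfolding lin_indep_def lat_root_def[symmetric] lat_root_aff
  proof (intro allI impI)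
    fix c i assume "aff_vec 0 (lat_root D (proj c)) (c None) = 0"
    then have c: "c None = 0" "lat_root D (proj c) = 0" by (simp_all add: aff_vec_eq_iff flip: aff_vec_zero)
    then have "lat_root D (proj c) = lat_root D (\<lambda>i. 0)" by (simp add: lat_root_def)
    then have "proj c = (\<lambda>i. 0)" by (rule inj_lat_root)
    then show "c i = 0" using proj_zero[of c] c(1) by (metis mult_zero_left)
  qed
  show "gcm_form ?D c c \<ge> 0" for c unfolding gcm_form_aff by (rule psd)
  show "(\<forall>i. c i = 0) \<or> (\<forall>i. c i > 0) \<or> (\<forall>i. c i < 0)" if "gcm_form ?D c c = 0" for c
  proof -
    obtain k where "c = (\<lambda>i. k * ?dl i)" using nul[OF \<open>gcm_form ?D c c = 0\<close>] by blast
    then show ?thesis using dlp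
      by (cases k "0 :: int" rule: linorder_cases) (auto simp: mult_neg_pos)
  qed
  show "(\<Sum>j\<in>UNIV. gcm ?D i j * ?dl j) = 0" for i
  proof -
    have "(\<Sum>j\<in>UNIV. gcm ?D i j * ?dl j) = gcm_form ?D (unit_at i) ?dl"
      by (simp add: gcm_form_def if_distrib[of "\<lambda>a. a * _"] if_distrib[of "\<lambda>a. sum a _"]
          sum.swap[of _ UNIV UNIV] cong: if_cong)
    also have "proj ?dl = (\<lambda>i. 0)" by (auto simp: proj_def)
    then have "gcm_form ?D (unit_at i) ?dl = 0" unfolding gcm_form_aff by (simp add: gcm_form_def)
    finally show ?thesis .
  qed
qed

end

text \<open>Simply-laced entries make the Cartan matrix symmetric, so the symmetrizer
  \<open>d\<close> is constant along links and, by indecomposability, constant. Dividing by it turns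
  the finite-type condition into definiteness of \<open>gcm_form\<close>.\<close>

lemma ADE_definite:
  assumes "ADE_type D" shows "definite_datum D"
proof -
  have km: "kac_moody D" and ft: "finite_type D" and ind: "indecomposable D" and sl: "simply_laced D"
    using assms by (auto simp: ADE_type_def)
  have diag: "gcm D i i = 2" and off: "i \<noteq> j \<Longrightarrow> gcm D i j \<le> 0" and z: "gcm D i j = 0 \<Longrightarrow> gcm D j i = 0" for i j
    using km by (auto simp: kac_moody_def)
  have sym: "gcm D i j = gcm D j i" for i j
    using sl z[of i j] z[of j i] unfolding simply_laced_def by (cases "i = j") (auto, metis)
  obtain d where d: "\<And>i. d i > 0" "\<And>i j. d i * of_int (gcm D i j) = d j * of_int (gcm D j i)"
    "\<And>v. (\<exists>i. v i \<noteq> 0) \<Longrightarrow> (\<Sum>i\<in>UNIV. \<Sum>j\<in>UNIV. v i * (d i * of_int (gcm D i j)) * v j) > (0::real)"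
    using ft unfolding finite_type_def by blast
  fix i0 :: 'a
  define J where "J = {i. d i = d i0}"
  have "gcm D i j = 0" if "i \<in> J" "j \<in> - J" for i j
    using d(2)[of i j] that sym[of i j] by (auto simp: J_def)
  moreover have "J \<noteq> {}" by (auto simp: J_def)
  ultimately have "J = UNIV" using ind unfolding indecomposable_def by blast
  define k where "k = d i0"
  have dk: "d i = k" for i using \<open>J = UNIV\<close> by (auto simp: J_def k_def)
  have pos: "gcm_form D c c > 0" if "\<exists>i. c i \<noteq> 0" for c
  proof -
    have "(\<Sum>i\<in>UNIV. \<Sum>j\<in>UNIV. of_int (c i) * (d i * of_int (gcm D i j)) * of_int (c j)) > (0::real)"
      using that by (intro d(3)) auto
    also have "(\<Sum>i\<in>UNIV. \<Sum>j\<in>UNIV. of_int (c i) * (d i * of_int (gcm D i j)) * of_int (c j))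
        = k * of_int (gcm_form D c c)"
      by (simp add: gcm_form_def sum_distrib_left dk mult_ac)
    finally show ?thesis using d(1)[of i0] dk by (simp add: zero_less_mult_iff)
  qed
  have zero: "gcm_form D c c = 0 \<Longrightarrow> c = (\<lambda>i. 0)" for c using pos[of c] by fastforce
  have psd: "gcm_form D c c \<ge> 0" for c
    using pos[of c] by (cases "\<exists>i. c i \<noteq> 0") (auto simp: gcm_form_def)
  show ?thesis
    by unfold_locales (use diag sym off km psd zero ind in \<open>auto simp: kac_moody_def dest: zero\<close>)
qed

lemma fundamental_weights_pairing:
  assumes "sum_of_fundamental_weights D \<rho>" shows "real_pairing (simple_coroot D j) \<rho> = 1"
proof -
  obtain \<Lambda> where L: "\<And>i j. real_pairing (simple_coroot D j) (\<Lambda> i) = (if i = j then 1 else 0)"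
    "\<rho> = (\<Sum>i\<in>UNIV. \<Lambda> i)" using assms unfolding sum_of_fundamental_weights_def by blast
  have "real_pairing (simple_coroot D j) \<rho> = (\<Sum>i\<in>UNIV. real_pairing (simple_coroot D j) (\<Lambda> i))"
    unfolding L(2) real_pairing_def by (simp add: sum_distrib_left) (rule sum.swap)
  then show ?thesis by (simp add: L(1))
qed

theorem theorem1p6:
  fixes D0 :: "('i::finite, 'r::finite) km_datum"
    and D :: "('i option, 'r aff_coord) km_datum"
    and \<rho> :: "real ^ 'r aff_coord"
    and x y :: "'r aff_coord waff"
  assumes "ADE_type D0"
    and "D = affinization D0"
    and "sum_of_fundamental_weights D \<rho>"
    and "x \<in> W_T D"
    and "y \<in> W_T D"
  shows "bruhat_covers D x y \<longleftrightarrow> bruhat_less D x y \<and> len D \<rho> x = len D \<rho> y - 1"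
proof -
  interpret definite_datum D0 by (rule ADE_definite[OF assms(1)])
  interpret aff: affine_datum D "case_option 1 mark"
    unfolding assms(2) by (rule affine_datum_affinization)
  show ?thesis by (rule aff.bruhat_covers_iff) (rule fundamental_weights_pairing[OF assms(3)])
qed

end
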